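(* Let $\Theta$ be an inner function on the unit disk $\mathbb{D}$, and let $\{\lambda_n\}$ be a sequence of points of $\mathbb{D}$ such that $\sup_n |\Theta(\lambda_n)|<1$. If the sequence of normalized reproducing kernels $\{\tilde k_{\lambda_n}\}$ is a Bessel sequence in $K_\Theta$, then it splits into finitely many Riesz basic sequences.
   Context: $H^2$ is the Hardy space of the unit disk $\mathbb{D}$ with the norm $\|\cdot\|_2=\|\cdot\|_{L^2(m)}$, where $m$ is normalized Lebesgue measure on the unit circle $\mathbb{T}$. For an inner function $\Theta$, the model subspace is $K_\Theta = H^2\ominus\Theta H^2$, a Hilbert space with the inner product of $H^2$. Its reproducing kernel at $\lambda\in\mathbb{D}$ is $k_\lambda(z)=\frac{1-\overline{\Theta(\lambda)}\Theta(z)}{1-\overline\lambda z}$, and $\tilde k_\lambda=k_\lambda/\|k_\lambda\|_2$ is the normalized kernel. A sequence of unit vectors $\{h_n\}$ in a separable Hilbert space $\mathcal H$ is a Bessel sequence if there is a constant $C>0$ with $\sum_n|\langle h,h_n\rangle_{\mathcal H}|^2\le C\|h\|_{\mathcal H}^2$ for every $h\in\mathcal H$. A sequence $\{h_n\}\subset\mathcal H$ is a Riesz basic sequence if there is a constant $A>0$ such that $A^{-1}\sum_n|c_n|^2\le\|\sum_n c_nh_n\|_{\mathcal H}^2\le A\sum_n|c_n|^2$ for every finite sequence $\{c_n\}\subset\mathbb{C}$. "Splits into finitely many Riesz basic sequences" means that the index set can be partitioned into finitely many subsets such that the subfamily corresponding to each subset is a Riesz basic sequence. *)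

theory Defs
  imports "HOL-Complex_Analysis.Complex_Analysis" "HOL-Library.Disjoint_Sets"
begin

definition circle_measure :: "complex measure" where
  "circle_measure =
     distr (uniform_measure lborel {0..2 * pi}) (restrict_space borel (sphere 0 1)) cis"

text \<open>Radial boundary values. On the null set of points of the circle where the radial limit
  does not exist, \<^const>\<open>Lim\<close> takes an unspecified constant value.\<close>

definition bdry :: "(complex \<Rightarrow> complex) \<Rightarrow> complex \<Rightarrow> complex" where
  "bdry f z = Lim (at_left 1) (\<lambda>r::real. f (of_real r * z))"

text \<open>Elements of the Hardy space are represented by functions on the whole plane of which only
  the restriction to the open unit disk matters.\<close>

definition hardy2 :: "(complex \<Rightarrow> complex) set" where
  "hardy2 = {f. f holomorphic_on ball 0 1 \<and>
     (\<exists>C. \<forall>r\<in>{0..<1::real}. (LINT z|circle_measure. (norm (f (of_real r * z)))\<^sup>2) \<le> C)}"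

definition hinner :: "(complex \<Rightarrow> complex) \<Rightarrow> (complex \<Rightarrow> complex) \<Rightarrow> complex" where
  "hinner f g = (LINT z|circle_measure. bdry f z * cnj (bdry g z))"

definition hnorm :: "(complex \<Rightarrow> complex) \<Rightarrow> real" where
  "hnorm f = sqrt (LINT z|circle_measure. (norm (bdry f z))\<^sup>2)"

definition inner_function :: "(complex \<Rightarrow> complex) \<Rightarrow> bool" where
  "inner_function \<Theta> \<longleftrightarrow> \<Theta> holomorphic_on ball 0 1 \<and> bounded (\<Theta> ` ball 0 1) \<and>
     (AE z in circle_measure.
        \<exists>l. ((\<lambda>r::real. \<Theta> (of_real r * z)) \<longlongrightarrow> l) (at_left 1) \<and> norm l = 1)"

definition model_space :: "(complex \<Rightarrow> complex) \<Rightarrow> (complex \<Rightarrow> complex) set" where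
  "model_space \<Theta> = {f \<in> hardy2. \<forall>g\<in>hardy2. hinner f (\<lambda>z. \<Theta> z * g z) = 0}"

definition model_kernel :: "(complex \<Rightarrow> complex) \<Rightarrow> complex \<Rightarrow> complex \<Rightarrow> complex" where
  "model_kernel \<Theta> w z = (1 - cnj (\<Theta> w) * \<Theta> z) / (1 - cnj w * z)"

definition normalized_kernel :: "(complex \<Rightarrow> complex) \<Rightarrow> complex \<Rightarrow> complex \<Rightarrow> complex" where
  "normalized_kernel \<Theta> w z = model_kernel \<Theta> w z / of_real (hnorm (model_kernel \<Theta> w))"

text \<open>Bessel and Riesz basic sequences in a subspace \<open>H\<close> of the Hardy space. As usual, a Bessel
  sequence consists of unit vectors of \<open>H\<close>. A Riesz basic sequence is a subfamily of
  \<open>h\<close>, indexed by a (possibly finite) set \<open>I\<close> of natural numbers.\<close>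

definition bessel_sequence ::
    "(complex \<Rightarrow> complex) set \<Rightarrow> (nat \<Rightarrow> complex \<Rightarrow> complex) \<Rightarrow> bool" where
  "bessel_sequence H h \<longleftrightarrow> (\<forall>n. h n \<in> H \<and> hnorm (h n) = 1) \<and>
     (\<exists>C>0. \<forall>f\<in>H. summable (\<lambda>n. (norm (hinner f (h n)))\<^sup>2) \<and>
        (\<Sum>n. (norm (hinner f (h n)))\<^sup>2) \<le> C * (hnorm f)\<^sup>2)"

definition riesz_basic_sequence ::
    "(complex \<Rightarrow> complex) set \<Rightarrow> nat set \<Rightarrow> (nat \<Rightarrow> complex \<Rightarrow> complex) \<Rightarrow> bool" where
  "riesz_basic_sequence H I h \<longleftrightarrow> (\<forall>n\<in>I. h n \<in> H) \<and>
     (\<exists>A>0. \<forall>F c. finite F \<and> F \<subseteq> I \<longrightarrow>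
        inverse A * (\<Sum>n\<in>F. (norm (c n))\<^sup>2) \<le> (hnorm (\<lambda>z. \<Sum>n\<in>F. c n * h n z))\<^sup>2 \<and>
        (hnorm (\<lambda>z. \<Sum>n\<in>F. c n * h n z))\<^sup>2 \<le> A * (\<Sum>n\<in>F. (norm (c n))\<^sup>2))"

definition splits_into_riesz_basic ::
    "(complex \<Rightarrow> complex) set \<Rightarrow> (nat \<Rightarrow> complex \<Rightarrow> complex) \<Rightarrow> bool" where
  "splits_into_riesz_basic H h \<longleftrightarrow>
     (\<exists>P. finite P \<and> partition_on UNIV P \<and> (\<forall>I\<in>P. riesz_basic_sequence H I h))"

end

theory Submission
  imports Defs "HOL-Real_Asymp.Real_Asymp"
begin

text \<open>Write \<open>q\<close> for the quadratic form of the Gram matrix of the normalized Szego kernels at the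
  points \<open>\<lambda>\<^sub>n\<close>. Up to a diagonal rescaling bounded above and below, the Gram form of the normalized
  model kernels is \<open>q(c) - q(c w)\<close> with \<open>w\<^sub>n = cnj (\<Theta>(\<lambda>\<^sub>n))\<close> and \<open>\<bar>w\<^sub>n\<bar> \<le> \<eta> < 1\<close>. The Bessel
  condition says \<open>q(c) - q(c w) \<le> C \<parallel>c\<parallel>\<^sup>2\<close>, and iterating gives \<open>q(c) \<le> C / (1 - \<eta>\<^sup>2) \<parallel>c\<parallel>\<^sup>2\<close>.
  Testing it on the kernels themselves bounds the row sums of the squared Gram matrix, so a greedy
  colouring splits the points into finitely many classes that are uniformly separated, and on which
  the Blaschke products \<open>\<Prod>\<^bsub>k\<noteq>n\<^esub> \<bar>b\<^sub>k(\<lambda>\<^sub>n)\<bar>\<close> are therefore bounded below. Duality turns this and the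
  upper bound of \<open>q\<close> into a lower bound of \<open>q\<close>. Splitting once more, so that \<open>\<Theta>(\<lambda>\<^sub>n)\<close> is nearly
  constant on each class, makes \<open>q(c w)\<close> at most a constant less than \<open>1\<close> times \<open>q(c)\<close>.\<close>

section \<open>Integration over the circle\<close>

lemma cis_measurable_circle:
  "cis \<in> uniform_measure lborel {0..2 * pi} \<rightarrow>\<^sub>M restrict_space borel (sphere 0 1)"
proof (rule measurable_restrict_space2)
  have "cis \<in> borel_measurable borel"
    by (intro borel_measurable_continuous_onI continuous_intros)
  then show "cis \<in> borel_measurable (uniform_measure lborel {0..2 * pi})"
    by (simp cong: measurable_cong_sets)
qed auto

lemma space_circle_measure [simp]: "space circle_measure = sphere 0 1"
  by (simp add: circle_measure_def space_restrict_space)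

lemma sets_circle_measure: "sets circle_measure = sets (restrict_space borel (sphere 0 1))"
  by (simp add: circle_measure_def)

lemma measurable_circle_continuous:
  fixes f :: "complex \<Rightarrow> 'b::topological_space"
  assumes "continuous_on (sphere 0 1) f"
  shows "f \<in> borel_measurable circle_measure"
  using borel_measurable_continuous_on_restrict[OF assms]
  by (simp add: sets_circle_measure cong: measurable_cong_sets)

lemma closed_sets_circle: "closed S \<Longrightarrow> S \<subseteq> sphere 0 1 \<Longrightarrow> S \<in> sets circle_measure"
  by (simp add: sets_circle_measure sets_restrict_space image_iff)
     (metis borel_closed inf.absorb_iff2)

lemma finite_measure_circle: "finite_measure circle_measure"
proof -
  have "finite_measure (uniform_measure lborel {0..2 * pi})"
    by (rule finite_measureI) (simp add: emeasure_uniform_measure ennreal_divide_eq_top_iff)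
  then show ?thesis
    unfolding circle_measure_def by (rule finite_measure.finite_measure_distr[OF _ cis_measurable_circle])
qed

global_interpretation circle: finite_measure circle_measure
  by (rule finite_measure_circle)

lemma integrable_circle_continuous:
  fixes f :: "complex \<Rightarrow> 'b::{banach, second_countable_topology}"
  assumes "continuous_on (sphere 0 1) f"
  shows "integrable circle_measure f"
proof -
  have "bounded (f ` sphere 0 1)"
    by (intro compact_imp_bounded compact_continuous_image assms) simp
  then obtain B where "\<And>z. z \<in> sphere 0 1 \<Longrightarrow> norm (f z) \<le> B"
    unfolding bounded_iff by blast
  then show ?thesis
    by (intro circle.integrable_const_bound[where B = B] measurable_circle_continuous assms AE_I2) simp
qed

text \<open>The uniform measure on \<open>{0..2 * pi}\<close> is \<open>lborel\<close> with density
  \<open>1 / (2 * pi)\<close> on that interval, and for a continuous integrand the Lebesgue and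
  gauge integrals agree. The gauge form is the one to which contour integrals reduce.\<close>

lemma integral_circle_cis:
  fixes f :: "complex \<Rightarrow> complex"
  assumes "continuous_on (sphere 0 1) f"
  shows "(LINT z|circle_measure. f z) = integral {0..2 * pi} (\<lambda>t. f (cis t)) / (2 * pi)"
proof -
  have m: "f \<in> borel_measurable (restrict_space borel (sphere 0 1))"
    by (rule borel_measurable_continuous_on_restrict[OF assms])
  have cf: "continuous_on UNIV (\<lambda>t. f (cis t))"
    by (rule continuous_on_compose2[OF assms]) (auto intro!: continuous_intros)
  have "uniform_measure lborel {0..2 * pi}
      = density lborel (\<lambda>t. ennreal (indicator {0..2 * pi} t / (2 * pi)))"
    unfolding uniform_measure_def
    by (intro arg_cong2[where f = density] refl ext) (auto simp: indicator_def simp flip: divide_ennreal)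
  then have "(LINT z|circle_measure. f z)
      = (LINT t|density lborel (\<lambda>t. ennreal (indicator {0..2 * pi} t / (2 * pi))). f (cis t))"
    unfolding circle_measure_def integral_distr[OF cis_measurable_circle m] by (simp only:)
  also have "\<dots> = (LINT t|lborel. (indicator {0..2 * pi} t / (2 * pi)) *\<^sub>R f (cis t))"
    using borel_measurable_continuous_onI[OF cf] by (intro integral_density) auto
  also have "\<dots> = (LINT t:{0..2 * pi}|lborel. f (cis t)) / (2 * pi)"
    unfolding set_lebesgue_integral_def
    by (subst integral_divide_zero[symmetric], intro Bochner_Integration.integral_cong)
       (auto simp: indicator_def scaleR_conv_of_real)
  also have "(LINT t:{0..2 * pi}|lborel. f (cis t)) = integral {0..2 * pi} (\<lambda>t. f (cis t))"
    by (intro set_borel_integral_eq_integral borel_integrable_atLeastAtMost'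
        continuous_on_subset[OF cf]) auto
  finally show ?thesis .
qed

text \<open>Cauchy's integral formula rewritten for normalized arc length. On the circle
  \<open>cnj z\<close> is the inverse of \<open>z\<close>, so \<open>z / (z - v)\<close> equals the
  conjugate of \<open>1 / (1 - cnj v * z)\<close>; this is the reproducing property of the Szego
  kernel for functions continuous up to the circle.\<close>

lemma cauchy_circle:
  assumes h: "continuous_on (cball 0 1) h" "h holomorphic_on ball 0 1" and v: "v \<in> ball 0 1"
  shows "(LINT z|circle_measure. h z * cnj (1 / (1 - cnj v * z))) = h v"
proof -
  have nz: "1 - v * cnj z \<noteq> 0" if "norm z = 1" for z
    using v that by (metis complex_mod_cnj dist_0_norm eq_iff_diff_eq_0 less_irrefl mem_ball mult.right_neutral norm_mult norm_one)
  have "continuous_on (sphere 0 1) (\<lambda>z. h z * cnj (1 / (1 - cnj v * z)))"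
    using nz by (auto intro!: continuous_intros continuous_on_subset[OF h(1)])
  then have "(LINT z|circle_measure. h z * cnj (1 / (1 - cnj v * z)))
      = integral {0..2 * pi} (\<lambda>t. h (cis t) * cnj (1 / (1 - cnj v * cis t))) / (2 * pi)"
    by (rule integral_circle_cis)
  also have "((\<lambda>t. h (cis t) * cnj (1 / (1 - cnj v * cis t))) has_integral (2 * pi * h v)) {0..2 * pi}"
  proof -
    have "((\<lambda>u. h u / (u - v)) has_contour_integral (2 * of_real pi * \<i> * h v)) (circlepath 0 1)"
      by (rule Cauchy_integral_circlepath) (use h v in auto)
    then have "((\<lambda>t. h (cis t) / (cis t - v) * \<i> * cis t) has_integral (2 * of_real pi * \<i> * h v)) {0..2 * pi}"
      unfolding circlepath_def by (subst (asm) has_contour_integral_part_circlepath_iff) (auto simp: cis_conv_exp)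
    from has_integral_mult_right[OF this, of "-\<i>"]
    have *: "((\<lambda>t. h (cis t) / (cis t - v) * cis t) has_integral (2 * of_real pi * h v)) {0..2 * pi}"
      by (simp add: algebra_simps)
    have "h (cis t) / (cis t - v) * cis t = h (cis t) * cnj (1 / (1 - cnj v * cis t))" for t
    proof -
      have "cis t * cnj (cis t) = 1" by (simp add: cis_cnj cis_mult)
      then have "cis t - v = cis t * (1 - v * cnj (cis t))"
        by (simp add: algebra_simps)
      then show ?thesis by simp
    qed
    with * show ?thesis by simp
  qed
  then have "integral {0..2 * pi} (\<lambda>t. h (cis t) * cnj (1 / (1 - cnj v * cis t))) = 2 * pi * h v"
    by (rule integral_unique)
  finally show ?thesis by simp
qed

section \<open>Radial boundary values\<close>

lemma in_ball_mult_sphere: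
  "z \<in> sphere 0 1 \<Longrightarrow> r \<in> {0..<1} \<Longrightarrow> of_real r * z \<in> ball (0::complex) 1"
  by (simp add: norm_mult)

lemma bdry_eq:
  assumes "((\<lambda>r::real. f (of_real r * z)) \<longlongrightarrow> l) (at_left 1)"
  shows "bdry f z = l"
  unfolding bdry_def by (intro tendsto_Lim assms) simp

text \<open>A fixed sequence of radii tending to 1 replaces the continuous parameter, so that
  measurability and the convergence theorems for sequences apply. The shift by 2 keeps every radius
  strictly positive.\<close>

definition radius :: "nat \<Rightarrow> real" where
  "radius k = 1 - 1 / real (k + 2)"

lemma radius_bounds: "radius k \<in> {0<..<1}"
  by (simp add: radius_def field_simps)

lemma radius_tendsto_1: "radius \<longlonglongrightarrow> 1"
  unfolding radius_def by real_asymp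

lemma filterlim_radius: "filterlim radius (at_left 1) sequentially"
  using radius_tendsto_1 radius_bounds by (auto simp: filterlim_at less_imp_neq)

lemma continuous_on_dilation:
  assumes "continuous_on (ball 0 1) f" "r \<in> {0..<1}" 
  shows "continuous_on (cball 0 1) (\<lambda>z::complex. f (of_real r * z))"
proof (rule continuous_on_compose2[OF assms(1)])
  show "(\<lambda>z. complex_of_real r * z) ` cball 0 1 \<subseteq> ball 0 1"
    using assms(2) by (auto simp: norm_mult) (metis le_less_trans mult_left_le)
qed (intro continuous_intros)

definition radial_limit_set :: "(complex \<Rightarrow> complex) \<Rightarrow> complex set" where
  "radial_limit_set f = {z \<in> sphere 0 1. \<exists>l. ((\<lambda>r::real. f (of_real r * z)) \<longlongrightarrow> l) (at_left 1)}"

text \<open>The Cauchy criterion, arranged for measurability: the outer quantifiers over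
  \<open>k\<close> and \<open>j\<close> are countable, while the uncountable ones over radii only
  intersect closed sets.\<close>

lemma radial_limit_set_Cauchy:
  "radial_limit_set f = (\<Inter>k::nat. \<Union>j::nat. {z \<in> sphere 0 1. \<forall>r\<in>{radius j<..<1}. \<forall>s\<in>{radius j<..<1}.
     dist (f (of_real r * z)) (f (of_real s * z)) \<le> 1 / Suc k})" (is "_ = ?R")
proof safe
  fix z k assume "z \<in> radial_limit_set f"
  then obtain l where z: "z \<in> sphere 0 1"
    and l: "((\<lambda>r::real. f (of_real r * z)) \<longlongrightarrow> l) (at_left 1)"
    by (auto simp: radial_limit_set_def)
  have "eventually (\<lambda>r::real. dist (f (of_real r * z)) l < 1 / Suc k / 2) (at_left 1)"
    using tendstoD[OF l, of "1 / Suc k / 2"] by simp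
  then obtain b where b: "b < 1" "\<And>r. b < r \<Longrightarrow> r < 1 \<Longrightarrow> dist (f (of_real r * z)) l < 1 / Suc k / 2"
    unfolding eventually_at_left_field by blast
  have "eventually (\<lambda>j. b < radius j) sequentially"
    using radius_tendsto_1 b(1) by (rule order_tendstoD)
  then obtain j where j: "b < radius j" by (auto simp: eventually_sequentially)
  have "dist (f (of_real r * z)) (f (of_real s * z)) \<le> 1 / Suc k"
    if "r \<in> {radius j<..<1}" "s \<in> {radius j<..<1}" for r s :: real
  proof -
    have "r > b" "s > b" using that j by auto
    with that b(2)[of r] b(2)[of s] dist_triangle2[of "f (of_real r * z)" "f (of_real s * z)" l]
    show ?thesis by (smt (verit) field_sum_of_halves greaterThanLessThan_iff)
  qed
  with z show "z \<in> (\<Union>j::nat. {z \<in> sphere 0 1. \<forall>r\<in>{radius j<..<1}. \<forall>s\<in>{radius j<..<1}.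
     dist (f (of_real r * z)) (f (of_real s * z)) \<le> 1 / Suc k})" by blast
next
  fix z assume z: "z \<in> ?R"
  then have zs: "z \<in> sphere 0 1" by blast
  have "convergent (\<lambda>j. f (of_real (radius j) * z))"
  proof (rule Cauchy_convergent, rule metric_CauchyI)
    fix e :: real assume "e > 0"
    then obtain k where k: "1 / Suc k < e" using nat_approx_posE by blast
    obtain j where j: "\<forall>r\<in>{radius j<..<1}. \<forall>s\<in>{radius j<..<1}.
       dist (f (of_real r * z)) (f (of_real s * z)) \<le> 1 / Suc k" using z by blast
    have "eventually (\<lambda>i. radius j < radius i) sequentially"
      using radius_tendsto_1 radius_bounds[of j] by (intro order_tendstoD) auto
    then obtain N where "\<And>i. i \<ge> N \<Longrightarrow> radius j < radius i"
      by (auto simp: eventually_sequentially)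
    with j k radius_bounds show "\<exists>M. \<forall>m\<ge>M. \<forall>n\<ge>M.
        dist (f (of_real (radius m) * z)) (f (of_real (radius n) * z)) < e"
      by (meson greaterThanLessThan_iff le_less_trans)
  qed
  then obtain l where l: "(\<lambda>j. f (of_real (radius j) * z)) \<longlonglongrightarrow> l"
    by (auto simp: convergent_def)
  have "((\<lambda>r::real. f (of_real r * z)) \<longlongrightarrow> l) (at_left 1)"
  proof (rule tendstoI)
    fix e :: real assume "e > 0"
    then obtain k where k: "1 / Suc k < e" using nat_approx_posE by blast
    obtain j where j: "\<forall>r\<in>{radius j<..<1}. \<forall>s\<in>{radius j<..<1}.
       dist (f (of_real r * z)) (f (of_real s * z)) \<le> 1 / Suc k" using z by blast
    have ev: "eventually (\<lambda>i. radius j < radius i) sequentially"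
      using radius_tendsto_1 radius_bounds[of j] by (intro order_tendstoD) auto
    \<comment> \<open>The limit \<open>l\<close> was found along \<open>radius\<close> only. Letting
      the second radius run to 1 along this sequence in the Cauchy estimate gives closeness to
      \<open>l\<close> for every \<open>r\<close> near 1.\<close>
    have "dist (f (of_real r * z)) l \<le> 1 / Suc k" if r: "r \<in> {radius j<..<1}" for r
    proof (rule tendsto_upperbound)
      show "(\<lambda>i. dist (f (of_real r * z)) (f (of_real (radius i) * z)))
          \<longlonglongrightarrow> dist (f (of_real r * z)) l"
        by (intro tendsto_intros l)
      show "\<forall>\<^sub>F i in sequentially. dist (f (of_real r * z)) (f (of_real (radius i) * z)) \<le> 1 / Suc k"
        using ev by eventually_elim (use j r radius_bounds in auto)
    qed simp
    with k show "eventually (\<lambda>r::real. dist (f (of_real r * z)) l < e) (at_left 1)"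
      unfolding eventually_at_left_field using radius_bounds[of j]
      by (intro exI[of _ "radius j"]) (auto intro: le_less_trans)
  qed
  with zs show "z \<in> radial_limit_set f" by (auto simp: radial_limit_set_def)
qed

lemma radial_limit_set_measurable:
  assumes "continuous_on (ball 0 1) f"
  shows "radial_limit_set f \<in> sets circle_measure"
proof -
  have "closed {z \<in> sphere 0 1. \<forall>r\<in>{radius j<..<1}. \<forall>s\<in>{radius j<..<1}.
     dist (f (of_real r * z)) (f (of_real s * z)) \<le> 1 / Suc k}" (is "closed ?S") for j k
  proof -
    have "?S = sphere 0 1 \<inter> (\<Inter>r\<in>{radius j<..<1}. \<Inter>s\<in>{radius j<..<1}.
       {z \<in> sphere 0 1. dist (f (of_real r * z)) (f (of_real s * z)) \<le> 1 / Suc k})"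
      by blast
    moreover have "closed {z \<in> sphere 0 1. dist (f (of_real r * z)) (f (of_real s * z)) \<le> 1 / Suc k}"
      if "r \<in> {radius j<..<1}" "s \<in> {radius j<..<1}" for r s
    proof -
      have "r \<in> {0..<1}" "s \<in> {0..<1}" using that radius_bounds[of j] by auto
      from this[THEN continuous_on_dilation[OF assms]] show ?thesis
        by (intro continuous_on_closed_Collect_le continuous_intros)
          (auto intro: continuous_on_subset)
    qed
    ultimately show ?thesis by (simp only:) (intro closed_Int closed_INT ballI closed_sphere, auto)
  qed
  then have "{z \<in> sphere 0 1. \<forall>r\<in>{radius j<..<1}. \<forall>s\<in>{radius j<..<1}.
     dist (f (of_real r * z)) (f (of_real s * z)) \<le> 1 / Suc k} \<in> sets circle_measure" for j k
    by (rule closed_sets_circle) blast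
  then show ?thesis unfolding radial_limit_set_Cauchy
    by (intro sets.countable_INT sets.countable_UN image_subsetI) simp_all
qed

lemma bdry_radius_tendsto:
  assumes "z \<in> radial_limit_set f"
  shows "(\<lambda>k. f (of_real (radius k) * z)) \<longlonglongrightarrow> bdry f z"
proof -
  from assms obtain l where l: "((\<lambda>r::real. f (of_real r * z)) \<longlongrightarrow> l) (at_left 1)"
    by (auto simp: radial_limit_set_def)
  then show ?thesis
    unfolding bdry_eq[OF l] by (rule filterlim_compose[OF _ filterlim_radius])
qed

text \<open>On the measurable set where radial limits exist, \<open>bdry f\<close> is a pointwise
  limit of continuous functions, and off this set it is constant.\<close>

lemma bdry_measurable:
  assumes "continuous_on (ball 0 1) f"
  shows "bdry f \<in> borel_measurable circle_measure"
proof -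
  \<comment> \<open>Where no limit exists, \<open>Lim\<close> is a definite description of an
    unsatisfiable predicate, hence the same value \<open>THE l. False\<close> at every such
    point.\<close>
  have eq: "bdry f z = (if z \<in> radial_limit_set f
      then lim (\<lambda>k. f (of_real (radius k) * z)) else (THE l. False))" if "z \<in> sphere 0 1" for z
  proof (cases "z \<in> radial_limit_set f")
    case True
    then show ?thesis using limI[OF bdry_radius_tendsto[OF True]] by simp
  next
    case False
    with that have "\<not> ((\<lambda>r::real. f (of_real r * z)) \<longlongrightarrow> l) (at_left 1)" for l
      by (auto simp: radial_limit_set_def)
    with False show ?thesis by (simp add: bdry_def Topological_Spaces.Lim_def)
  qed
  have [measurable]: "(\<lambda>z. f (of_real (radius k) * z)) \<in> borel_measurable circle_measure" for k
    using radius_bounds[of k]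
    by (intro measurable_circle_continuous continuous_on_subset[OF continuous_on_dilation[OF assms]]) auto
  note radial_limit_set_measurable[OF assms, measurable]
  have "(\<lambda>z. if z \<in> radial_limit_set f
      then lim (\<lambda>k. f (of_real (radius k) * z)) else (THE l. False)) \<in> borel_measurable circle_measure"
    by measurable
  then show ?thesis
    by (rule measurable_cong[THEN iffD1, rotated]) (simp add: eq)
qed

text \<open>By Fatou's lemma for integrals this needs no existence theorem for radial limits: where the
  limit fails to exist \<^const>\<open>bdry\<close> is constant.\<close>

lemma hardy2_bdry_square_integrable:
  assumes "f \<in> hardy2"
  shows "integrable circle_measure (\<lambda>z. (norm (bdry f z))\<^sup>2)"
proof (rule integrableI_bounded)
  from assms obtain C where hol: "f holomorphic_on ball 0 1"
    and C: "\<And>r. r \<in> {0..<1} \<Longrightarrow> (LINT z|circle_measure. (norm (f (of_real r * z)))\<^sup>2) \<le> C"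
    unfolding hardy2_def by blast
  have cont: "continuous_on (ball 0 1) f" by (rule holomorphic_on_imp_continuous_on[OF hol])
  note bdry_measurable[OF cont, measurable] radial_limit_set_measurable[OF cont, measurable]
  show "(\<lambda>z. (norm (bdry f z))\<^sup>2) \<in> borel_measurable circle_measure" by measurable
  have r: "radius k \<in> {0..<1}" for k using radius_bounds[of k] by auto
  have cont2: "continuous_on (sphere 0 1) (\<lambda>z. f (of_real (radius k) * z))" for k
    by (rule continuous_on_subset[OF continuous_on_dilation[OF cont r]]) auto
  note [measurable] = measurable_circle_continuous[OF cont2]
  \<comment> \<open>The default value of \<open>bdry\<close>. Adding its constant square to the
    Fatou bound covers the points without radial limit, and this costs only a finite amount since
    the measure is finite.\<close>
  define c :: complex where "c = (THE l. False)"
  have le: "ennreal (norm ((norm (bdry f z))\<^sup>2))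
      \<le> liminf (\<lambda>k. ennreal ((norm (f (of_real (radius k) * z)))\<^sup>2)) + ennreal ((norm c)\<^sup>2)"
    if "z \<in> sphere 0 1" for z
  proof (cases "z \<in> radial_limit_set f")
    case True
    have "(\<lambda>k. ennreal ((norm (f (of_real (radius k) * z)))\<^sup>2)) \<longlonglongrightarrow> ennreal ((norm (bdry f z))\<^sup>2)"
      by (intro tendsto_intros bdry_radius_tendsto True)
    then have "liminf (\<lambda>k. ennreal ((norm (f (of_real (radius k) * z)))\<^sup>2)) = ennreal ((norm (bdry f z))\<^sup>2)"
      by (rule lim_imp_Liminf[rotated]) simp
    then show ?thesis by simp
  next
    case False
    with that have "\<not> ((\<lambda>r::real. f (of_real r * z)) \<longlongrightarrow> l) (at_left 1)" for l
      by (auto simp: radial_limit_set_def)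
    then have "bdry f z = c" by (simp add: bdry_def Topological_Spaces.Lim_def c_def)
    then show ?thesis by simp
  qed
  have "(\<integral>\<^sup>+ z. ennreal (norm ((norm (bdry f z))\<^sup>2)) \<partial>circle_measure)
      \<le> (\<integral>\<^sup>+ z. liminf (\<lambda>k. ennreal ((norm (f (of_real (radius k) * z)))\<^sup>2)) + ennreal ((norm c)\<^sup>2) \<partial>circle_measure)"
    by (intro nn_integral_mono) (use le in simp)
  also have "\<dots> = (\<integral>\<^sup>+ z. liminf (\<lambda>k. ennreal ((norm (f (of_real (radius k) * z)))\<^sup>2)) \<partial>circle_measure)
      + (\<integral>\<^sup>+ z. ennreal ((norm c)\<^sup>2) \<partial>circle_measure)"
    by (intro nn_integral_add) measurable
  also have "(\<integral>\<^sup>+ z. liminf (\<lambda>k. ennreal ((norm (f (of_real (radius k) * z)))\<^sup>2)) \<partial>circle_measure)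
      \<le> liminf (\<lambda>k. \<integral>\<^sup>+ z. ennreal ((norm (f (of_real (radius k) * z)))\<^sup>2) \<partial>circle_measure)"
    by (intro nn_integral_liminf) measurable
  also have "\<dots> \<le> liminf (\<lambda>k::nat. ennreal C)"
  proof (intro Liminf_mono always_eventually allI)
    fix k
    have "(\<integral>\<^sup>+ z. ennreal ((norm (f (of_real (radius k) * z)))\<^sup>2) \<partial>circle_measure)
        = ennreal (LINT z|circle_measure. (norm (f (of_real (radius k) * z)))\<^sup>2)"
      by (intro nn_integral_eq_integral integrable_circle_continuous continuous_intros cont2 AE_I2) simp
    also have "\<dots> \<le> ennreal C" by (intro ennreal_leI C r)
    finally show "(\<integral>\<^sup>+ z. ennreal ((norm (f (of_real (radius k) * z)))\<^sup>2) \<partial>circle_measure) \<le> ennreal C" .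
  qed
  also have "\<dots> + (\<integral>\<^sup>+ z. ennreal ((norm c)\<^sup>2) \<partial>circle_measure) < \<infinity>"
    using circle.emeasure_finite[of "sphere 0 1"]
    by (auto simp: ennreal_mult_eq_top_iff less_top[symmetric] Liminf_const)
  finally show "(\<integral>\<^sup>+ z. ennreal (norm ((norm (bdry f z))\<^sup>2)) \<partial>circle_measure) < \<infinity>"
    by (simp add: add_mono)
qed

section \<open>Membership in the Hardy space\<close>

lemma bounded_imp_hardy2:
  assumes "f holomorphic_on ball 0 1" "bounded (f ` ball 0 1)"
  shows "f \<in> hardy2"
proof -
  from assms(2) obtain B where B: "\<And>z. z \<in> ball 0 1 \<Longrightarrow> norm (f z) \<le> B"
    unfolding bounded_iff by blast
  have "(LINT z|circle_measure. (norm (f (of_real r * z)))\<^sup>2) \<le> (LINT z|circle_measure. B\<^sup>2)"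
    if "r \<in> {0..<1}" for r
  proof (intro integral_mono integrable_circle_continuous continuous_intros
      continuous_on_subset[OF continuous_on_dilation[OF holomorphic_on_imp_continuous_on[OF assms(1)] that]])
    fix z assume "z \<in> space circle_measure"
    then have "of_real r * z \<in> ball 0 1" using that by (intro in_ball_mult_sphere) auto
    from B[OF this] show "(norm (f (of_real r * z)))\<^sup>2 \<le> B\<^sup>2" by (intro power_mono) auto
  qed auto
  with assms(1) show ?thesis unfolding hardy2_def by blast
qed

lemma hardy2_mult_bounded:
  assumes "g \<in> hardy2" "f holomorphic_on ball 0 1" "bounded (f ` ball 0 1)"
  shows "(\<lambda>z. f z * g z) \<in> hardy2"
proof -
  from assms(3) obtain B where B: "\<And>z. z \<in> ball 0 1 \<Longrightarrow> norm (f z) \<le> B"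
    unfolding bounded_iff by blast
  from assms(1) obtain C where hol: "g holomorphic_on ball 0 1"
    and C: "\<And>r. r \<in> {0..<1} \<Longrightarrow> (LINT z|circle_measure. (norm (g (of_real r * z)))\<^sup>2) \<le> C"
    unfolding hardy2_def by blast
  have "(LINT z|circle_measure. (norm (f (of_real r * z) * g (of_real r * z)))\<^sup>2) \<le> B\<^sup>2 * C"
    if "r \<in> {0..<1}" for r
  proof -
    note c = continuous_on_dilation[OF holomorphic_on_imp_continuous_on that, THEN continuous_on_subset]
    have "(LINT z|circle_measure. (norm (f (of_real r * z) * g (of_real r * z)))\<^sup>2)
        \<le> (LINT z|circle_measure. B\<^sup>2 * (norm (g (of_real r * z)))\<^sup>2)"
    proof (intro integral_mono integrable_circle_continuous continuous_intros c assms(2) hol)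
      fix z assume "z \<in> space circle_measure"
      then have "of_real r * z \<in> ball 0 1" using that by (intro in_ball_mult_sphere) auto
      from B[OF this] show "(norm (f (of_real r * z) * g (of_real r * z)))\<^sup>2 \<le> B\<^sup>2 * (norm (g (of_real r * z)))\<^sup>2"
        unfolding norm_mult power_mult_distrib by (intro mult_right_mono power_mono) auto
    qed auto
    also have "\<dots> \<le> B\<^sup>2 * C" using C[OF that] by (simp add: mult_left_mono)
    finally show ?thesis .
  qed
  moreover have "(\<lambda>z. f z * g z) holomorphic_on ball 0 1" by (intro holomorphic_intros hol assms(2))
  ultimately show ?thesis unfolding hardy2_def by blast
qed

section \<open>Reproducing kernels\<close>

definition square_integrable :: "(complex \<Rightarrow> complex) \<Rightarrow> bool" where
  "square_integrable f \<longleftrightarrow> f \<in> borel_measurable circle_measure \<and>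
     integrable circle_measure (\<lambda>z. (norm (f z))\<^sup>2)"

lemma square_integrable_mult_cnj:
  assumes "square_integrable f" "square_integrable g"
  shows "integrable circle_measure (\<lambda>z. f z * cnj (g z))"
proof (rule Bochner_Integration.integrable_bound)
  show "integrable circle_measure (\<lambda>z. (norm (f z))\<^sup>2 + (norm (g z))\<^sup>2)"
    using assms by (auto simp: square_integrable_def)
  have [measurable]: "f \<in> borel_measurable circle_measure" "g \<in> borel_measurable circle_measure"
    using assms by (auto simp: square_integrable_def)
  have "(\<lambda>z. cnj (g z)) \<in> borel_measurable circle_measure"
    by (rule borel_measurable_continuous_on[where f = cnj]) (auto intro!: continuous_intros)
  then show "(\<lambda>z. f z * cnj (g z)) \<in> borel_measurable circle_measure" by measurable
  have "norm (f z * cnj (g z)) \<le> norm ((norm (f z))\<^sup>2 + (norm (g z))\<^sup>2)" for z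
  proof -
    have "0 \<le> norm (f z) * norm (g z)" by simp
    with sum_squares_bound[of "norm (f z)" "norm (g z)"]
    have "norm (f z) * norm (g z) \<le> (norm (f z))\<^sup>2 + (norm (g z))\<^sup>2" by linarith
    then show ?thesis by (simp add: norm_mult)
  qed
  then show "AE z in circle_measure. norm (f z * cnj (g z)) \<le> norm ((norm (f z))\<^sup>2 + (norm (g z))\<^sup>2)"
    by simp
qed

lemma square_integrable_continuous:
  "continuous_on (sphere 0 1) f \<Longrightarrow> square_integrable f"
  unfolding square_integrable_def
  by (intro conjI measurable_circle_continuous integrable_circle_continuous continuous_intros)

lemma square_integrable_hardy2: "f \<in> hardy2 \<Longrightarrow> square_integrable (bdry f)"
  unfolding square_integrable_def
  by (intro conjI bdry_measurable hardy2_bdry_square_integrable)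
     (auto simp: hardy2_def holomorphic_on_imp_continuous_on)

text \<open>The square norm of a linear combination as the quadratic form of its Gram matrix; square
  integrability of the \<open>f n\<close> allows the double sum to be integrated term by
  term.\<close>

lemma integral_norm_sum_square:
  assumes "\<And>n. n \<in> F \<Longrightarrow> square_integrable (f n)"
  shows "complex_of_real (LINT z|circle_measure. (norm (\<Sum>n\<in>F. c n * f n z))\<^sup>2)
    = (\<Sum>m\<in>F. \<Sum>n\<in>F. c m * cnj (c n) * (LINT z|circle_measure. f m z * cnj (f n z)))"
proof -
  have "complex_of_real (LINT z|circle_measure. (norm (\<Sum>n\<in>F. c n * f n z))\<^sup>2)
      = (LINT z|circle_measure. complex_of_real ((norm (\<Sum>n\<in>F. c n * f n z))\<^sup>2))"
    by (rule integral_complex_of_real[symmetric])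
  also have "\<dots> = (LINT z|circle_measure. (\<Sum>m\<in>F. \<Sum>n\<in>F. c m * cnj (c n) * (f m z * cnj (f n z))))"
    by (intro Bochner_Integration.integral_cong refl)
       (simp only: complex_norm_square, simp add: sum_product cnj_sum mult_ac)
  also have "\<dots> = (\<Sum>m\<in>F. \<Sum>n\<in>F. c m * cnj (c n) * (LINT z|circle_measure. f m z * cnj (f n z)))"
    by (simp add: Bochner_Integration.integral_sum square_integrable_mult_cnj assms)
  finally show ?thesis .
qed

text \<open>The reproducing kernel of the whole Hardy space, to which \<open>model_kernel\<close>
  reduces for \<Theta> = 0.\<close>

definition szego :: "complex \<Rightarrow> complex \<Rightarrow> complex" where
  "szego w z = 1 / (1 - cnj w * z)"

lemma szego_denom_nonzero:
  assumes "w \<in> ball 0 1" "z \<in> cball 0 1"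
  shows "1 - cnj w * z \<noteq> 0"
proof
  assume "1 - cnj w * z = 0"
  then have "norm w * norm z = 1"
    by (metis complex_mod_cnj eq_iff_diff_eq_0 norm_mult norm_one)
  moreover have "norm w * norm z \<le> norm w" using assms by (simp add: mult_left_le)
  ultimately show False using assms by simp
qed

lemma cnj_szego: "cnj (szego w v) = szego v w"
  by (simp add: szego_def mult.commute)

lemma szego_continuous: "w \<in> ball 0 1 \<Longrightarrow> continuous_on (cball 0 1) (szego w)"
  unfolding szego_def by (intro continuous_intros ballI szego_denom_nonzero)

lemma szego_holomorphic: "w \<in> ball 0 1 \<Longrightarrow> szego w holomorphic_on ball 0 1"
  unfolding szego_def using szego_denom_nonzero ball_subset_cball
  by (intro holomorphic_intros) blast

lemma cauchy_szego:
  assumes "continuous_on (cball 0 1) h" "h holomorphic_on ball 0 1" and "v \<in> ball 0 1"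
  shows "(LINT z|circle_measure. h z * cnj (szego v z)) = h v"
  unfolding szego_def by (rule cauchy_circle[OF assms])

text \<open>A bounded holomorphic \<open>f\<close> need not extend continuously to the circle, so
  Cauchy's formula is applied to the dilations of \<open>f\<close>. Boundedness permits dominated
  convergence as the radius tends to 1.\<close>

lemma cauchy_szego_bdry:
  assumes hol: "f holomorphic_on ball 0 1" and bdd: "bounded (f ` ball 0 1)"
    and lim: "AE z in circle_measure. z \<in> radial_limit_set f"
    and w: "w \<in> ball 0 1" and v: "v \<in> ball 0 1"
  shows "(LINT z|circle_measure. bdry f z * szego w z * cnj (szego v z)) = f v * szego w v"
\<comment> \<open>The same sequence of integrals has two limits: dominated convergence gives the
  boundary integral, and Cauchy's formula with continuity of \<open>f\<close> at \<open>v\<close>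
  gives the value.\<close>
proof (rule LIMSEQ_unique)
  from bdd obtain B where B: "\<And>z. z \<in> ball 0 1 \<Longrightarrow> norm (f z) \<le> B"
    unfolding bounded_iff by blast
  note cont = holomorphic_on_imp_continuous_on[OF hol]
  have r: "radius k \<in> {0..<1}" for k using radius_bounds[of k] by auto
  have sub: "sphere 0 1 \<subseteq> cball (0::complex) 1" by auto
  note dil = continuous_on_dilation[OF cont r]
  have cs: "continuous_on (sphere 0 1) (\<lambda>z. szego w z * cnj (szego v z))"
    using continuous_on_subset[OF szego_continuous[OF w] sub]
      continuous_on_subset[OF szego_continuous[OF v] sub] by (intro continuous_intros)
  note [measurable] = bdry_measurable[OF cont] measurable_circle_continuous[OF cs]
    measurable_circle_continuous[OF continuous_on_subset[OF dil sub]]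
  have "(\<lambda>k. LINT z|circle_measure. f (of_real (radius k) * z) * (szego w z * cnj (szego v z)))
      \<longlonglongrightarrow> (LINT z|circle_measure. bdry f z * (szego w z * cnj (szego v z)))"
  proof (rule integral_dominated_convergence)
    show "integrable circle_measure (\<lambda>z. B * norm (szego w z * cnj (szego v z)))"
      by (intro integrable_circle_continuous continuous_intros cs)
    show "AE z in circle_measure. (\<lambda>k. f (of_real (radius k) * z) * (szego w z * cnj (szego v z)))
        \<longlonglongrightarrow> bdry f z * (szego w z * cnj (szego v z))"
      using lim by eventually_elim (intro tendsto_intros bdry_radius_tendsto)
    show "AE z in circle_measure. norm (f (of_real (radius k) * z) * (szego w z * cnj (szego v z)))
        \<le> B * norm (szego w z * cnj (szego v z))" for k
      by (intro AE_I2, subst norm_mult, intro mult_right_mono B in_ball_mult_sphere r) auto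
  qed measurable
  then show "(\<lambda>k. LINT z|circle_measure. f (of_real (radius k) * z) * szego w z * cnj (szego v z))
      \<longlonglongrightarrow> (LINT z|circle_measure. bdry f z * szego w z * cnj (szego v z))"
    by (simp add: mult.assoc)
  have "(LINT z|circle_measure. f (of_real (radius k) * z) * szego w z * cnj (szego v z))
      = f (of_real (radius k) * v) * szego w v" for k
  proof (rule cauchy_szego)
    show "continuous_on (cball 0 1) (\<lambda>z. f (of_real (radius k) * z) * szego w z)"
      by (intro continuous_intros dil szego_continuous w)
    have "(\<lambda>z. of_real (radius k) * z) ` ball 0 1 \<subseteq> ball (0::complex) 1"
      using r[of k] by (auto simp: norm_mult) (metis le_less_trans mult_left_le_one_le norm_ge_zero less_imp_le)
    then have "(f \<circ> (\<lambda>z. of_real (radius k) * z)) holomorphic_on ball 0 1"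
      by (intro holomorphic_on_compose_gen[OF _ hol] holomorphic_intros)
    then show "(\<lambda>z. f (of_real (radius k) * z) * szego w z) holomorphic_on ball 0 1"
      by (intro holomorphic_intros szego_holomorphic w) (simp add: o_def)
  qed (rule v)
  moreover have "(\<lambda>k. f (of_real (radius k) * v) * szego w v) \<longlonglongrightarrow> f v * szego w v"
  proof (intro tendsto_intros)
    have "isCont f v" using cont v by (simp add: continuous_on_eq_continuous_at)
    moreover have "(\<lambda>k. of_real (radius k) * v) \<longlonglongrightarrow> of_real 1 * v"
      by (intro tendsto_intros radius_tendsto_1)
    ultimately show "(\<lambda>k. f (of_real (radius k) * v)) \<longlonglongrightarrow> f v"
      using isCont_tendsto_compose[of v f] by simp
  qed
  ultimately show "(\<lambda>k. LINT z|circle_measure. f (of_real (radius k) * z) * szego w z * cnj (szego v z))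
      \<longlonglongrightarrow> f v * szego w v" by simp
qed

section \<open>Gram matrix of the model kernels\<close>

lemma inner_function_bdry:
  assumes "inner_function \<Theta>"
  shows "AE z in circle_measure. z \<in> radial_limit_set \<Theta>"
    and "AE z in circle_measure. norm (bdry \<Theta> z) = 1"
proof -
  from assms have *: "AE z in circle_measure.
        \<exists>l. ((\<lambda>r::real. \<Theta> (of_real r * z)) \<longlongrightarrow> l) (at_left 1) \<and> norm l = 1"
    by (simp add: inner_function_def)
  with AE_space show "AE z in circle_measure. z \<in> radial_limit_set \<Theta>"
    by eventually_elim (auto simp: radial_limit_set_def)
  from * show "AE z in circle_measure. norm (bdry \<Theta> z) = 1"
    by eventually_elim (auto dest: bdry_eq)
qed

text \<open>The Szego factor is continuous up to the circle, so a radial limit of \<Theta>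
  suffices.\<close>

lemma model_kernel_radial_limit:
  assumes "z \<in> radial_limit_set \<Theta>" "w \<in> ball 0 1"
  shows "((\<lambda>r::real. model_kernel \<Theta> w (of_real r * z)) \<longlongrightarrow>
     (1 - cnj (\<Theta> w) * bdry \<Theta> z) * szego w z) (at_left 1)"
proof -
  from assms(1) obtain l where z: "z \<in> sphere 0 1"
    and l: "((\<lambda>r::real. \<Theta> (of_real r * z)) \<longlongrightarrow> l) (at_left 1)"
    by (auto simp: radial_limit_set_def)
  have "((\<lambda>r::real. of_real r * z) \<longlongrightarrow> of_real 1 * z) (at_left 1)"
    by (intro tendsto_intros)
  then have "((\<lambda>r::real. of_real r * z) \<longlongrightarrow> z) (at_left 1)" by simp
  then show ?thesis
    unfolding model_kernel_def szego_def bdry_eq[OF l]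
    using szego_denom_nonzero[OF assms(2), of z] z l by (auto intro!: tendsto_eq_intros)
qed

text \<open>The reproducing property of the model kernels, tested on the kernels themselves. After
  expanding the product on the circle, \<open>norm (bdry \<Theta> z) = 1\<close> makes the term
  quadratic in \<Theta> constant, and what remains are Cauchy integrals against Szego
  kernels.\<close>

lemma hinner_model_kernel:
  assumes \<Theta>: "inner_function \<Theta>" and w: "w \<in> ball 0 1" and v: "v \<in> ball 0 1"
  shows "hinner (model_kernel \<Theta> w) (model_kernel \<Theta> v) = (1 - cnj (\<Theta> w) * \<Theta> v) * szego w v"
proof -
  note AE = inner_function_bdry[OF \<Theta>]
  have hol: "\<Theta> holomorphic_on ball 0 1" and bdd: "bounded (\<Theta> ` ball 0 1)"
    using \<Theta> by (auto simp: inner_function_def)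
  have cont: "continuous_on (ball 0 1) (model_kernel \<Theta> u)" if "u \<in> ball 0 1" for u
    unfolding model_kernel_def using szego_denom_nonzero[OF that] ball_subset_cball
    by (intro continuous_intros holomorphic_on_imp_continuous_on[OF hol]) blast
  have sub: "sphere 0 1 \<subseteq> cball (0::complex) 1" by auto
  have cs: "continuous_on (sphere 0 1) (szego u)" if "u \<in> ball 0 1" for u
    using continuous_on_subset[OF szego_continuous[OF that] sub] .
  have cs2: "continuous_on (sphere 0 1) (\<lambda>z. cnj (szego u z))" if "u \<in> ball 0 1" for u
    using cs[OF that] by (intro continuous_intros)
  have mcnj: "(\<lambda>z. cnj (f z)) \<in> borel_measurable circle_measure"
    if "f \<in> borel_measurable circle_measure" for f
    by (rule borel_measurable_continuous_on[OF _ that]) (auto intro!: continuous_intros)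
  note [measurable] = bdry_measurable[OF holomorphic_on_imp_continuous_on[OF hol]]
     bdry_measurable[OF cont[OF w]] bdry_measurable[OF cont[OF v]]
     measurable_circle_continuous[OF cs[OF w]] measurable_circle_continuous[OF cs[OF v]]
     measurable_circle_continuous[OF cs2[OF w]] measurable_circle_continuous[OF cs2[OF v]]
     mcnj
  define T where "T = bdry \<Theta>"
  have T [measurable]: "T \<in> borel_measurable circle_measure" unfolding T_def by measurable
  have "square_integrable T" unfolding T_def
    by (intro square_integrable_hardy2 bounded_imp_hardy2 hol bdd)
  have intT: "integrable circle_measure (\<lambda>z. T z * szego a z * cnj (szego b z))"
    if "a \<in> ball 0 1" "b \<in> ball 0 1" for a b
  proof -
    have "square_integrable (\<lambda>z. cnj (szego a z) * szego b z)"
      using that by (intro square_integrable_continuous continuous_intros cs cs2)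
    from square_integrable_mult_cnj[OF \<open>square_integrable T\<close> this] show ?thesis
      by (simp add: mult.assoc)
  qed
  have int0: "integrable circle_measure (\<lambda>z. szego w z * cnj (szego v z))"
    using w v by (intro integrable_circle_continuous continuous_intros cs cs2)
  have intC: "integrable circle_measure (\<lambda>z. cnj (T z * szego v z * cnj (szego w z)))"
    using intT[OF v w] by (simp only: integrable_cnj)
  have "hinner (model_kernel \<Theta> w) (model_kernel \<Theta> v)
    = (LINT z|circle_measure. (1 + cnj (\<Theta> w) * \<Theta> v) * (szego w z * cnj (szego v z))
         - cnj (\<Theta> w) * (T z * szego w z * cnj (szego v z))
         - \<Theta> v * cnj (T z * szego v z * cnj (szego w z)))"
    unfolding hinner_def
  proof (rule integral_cong_AE)
    show "AE z in circle_measure. bdry (model_kernel \<Theta> w) z * cnj (bdry (model_kernel \<Theta> v) z)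
       = (1 + cnj (\<Theta> w) * \<Theta> v) * (szego w z * cnj (szego v z))
         - cnj (\<Theta> w) * (T z * szego w z * cnj (szego v z))
         - \<Theta> v * cnj (T z * szego v z * cnj (szego w z))"
      using AE
    proof eventually_elim
      case (elim z)
      have "T z * cnj (T z) = 1" using elim(2) by (simp add: T_def complex_norm_square[symmetric])
      then have T1: "cnj (\<Theta> w) * \<Theta> v * (T z * cnj (T z)) = cnj (\<Theta> w) * \<Theta> v" by simp
      have b: "bdry (model_kernel \<Theta> w) z = (1 - cnj (\<Theta> w) * T z) * szego w z"
           "bdry (model_kernel \<Theta> v) z = (1 - cnj (\<Theta> v) * T z) * szego v z"
        unfolding T_def by (intro bdry_eq model_kernel_radial_limit elim w v)+
      have "bdry (model_kernel \<Theta> w) z * cnj (bdry (model_kernel \<Theta> v) z)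
        = (1 - cnj (\<Theta> w) * T z - \<Theta> v * cnj (T z) + cnj (\<Theta> w) * \<Theta> v * (T z * cnj (T z)))
          * (szego w z * cnj (szego v z))"
        unfolding b by (simp add: algebra_simps)
      then show ?case unfolding T1 by (simp add: algebra_simps)
    qed
  qed measurable
  also have "\<dots> = (1 + cnj (\<Theta> w) * \<Theta> v) * (LINT z|circle_measure. szego w z * cnj (szego v z))
         - cnj (\<Theta> w) * (LINT z|circle_measure. T z * szego w z * cnj (szego v z))
         - \<Theta> v * cnj (LINT z|circle_measure. T z * szego v z * cnj (szego w z))"
    using int0 intT[OF w v] intC by (simp del: complex_cnj_mult add: integral_cnj)
  also have "(LINT z|circle_measure. szego w z * cnj (szego v z)) = szego w v"
    by (intro cauchy_szego szego_continuous szego_holomorphic w v)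
  also have "(LINT z|circle_measure. T z * szego w z * cnj (szego v z)) = \<Theta> v * szego w v"
    unfolding T_def by (intro cauchy_szego_bdry hol bdd AE w v)
  also have "(LINT z|circle_measure. T z * szego v z * cnj (szego w z)) = \<Theta> w * szego v w"
    unfolding T_def by (intro cauchy_szego_bdry hol bdd AE w v)
  finally show ?thesis by (simp add: cnj_szego algebra_simps)
qed

section \<open>The Gram form of the Szego kernels\<close>

text \<open>The reciprocal of the norm of the Szego kernel at \<open>w\<close>, so that
  \<open>szego_gram\<close> is the Gram matrix of unit vectors.\<close>

definition szego_weight :: "complex \<Rightarrow> real" where
  "szego_weight w = sqrt (1 - (norm w)\<^sup>2)"

definition szego_gram :: "complex \<Rightarrow> complex \<Rightarrow> complex" where
  "szego_gram w v = of_real (szego_weight w) * of_real (szego_weight v) * szego w v"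

definition szego_comb :: "(nat \<Rightarrow> complex) \<Rightarrow> nat set \<Rightarrow> (nat \<Rightarrow> complex) \<Rightarrow> complex \<Rightarrow> complex" where
  "szego_comb a F c z = (\<Sum>n\<in>F. c n * (of_real (szego_weight (a n)) * szego (a n) z))"

text \<open>Defined as an integral, so that positivity is immediate and pointwise inequalities on
  the circle can be integrated. The matrix form is recovered in
  \<open>szego_form_gram\<close>.\<close>

definition szego_form :: "(nat \<Rightarrow> complex) \<Rightarrow> nat set \<Rightarrow> (nat \<Rightarrow> complex) \<Rightarrow> real" where
  "szego_form a F c = (LINT z|circle_measure. (norm (szego_comb a F c z))\<^sup>2)"

definition blaschke :: "complex \<Rightarrow> complex \<Rightarrow> complex" where
  "blaschke w z = (z - w) * szego w z"

lemma norm_sq_less_1: "w \<in> ball 0 1 \<Longrightarrow> (norm (w::complex))\<^sup>2 < 1"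
  by (simp add: power_less_one_iff)

lemma szego_weight_pos: "w \<in> ball 0 1 \<Longrightarrow> szego_weight w > 0"
  using norm_sq_less_1[of w] by (simp add: szego_weight_def)

lemma szego_weight_sq: "w \<in> ball 0 1 \<Longrightarrow> (szego_weight w)\<^sup>2 = 1 - (norm w)\<^sup>2"
  using norm_sq_less_1[of w] by (simp add: szego_weight_def)

lemma szego_diag: "w \<in> ball 0 1 \<Longrightarrow> of_real (szego_weight w) * (of_real (szego_weight w) * szego w w) = 1"
proof -
  assume w: "w \<in> ball 0 1"
  have "cnj w * w = complex_of_real ((norm w)\<^sup>2)" by (simp only: complex_norm_square mult.commute)
  then have "1 - cnj w * w = of_real ((szego_weight w)\<^sup>2)" by (simp add: szego_weight_sq[OF w])
  then show ?thesis using szego_weight_pos[OF w] by (simp add: szego_def power2_eq_square)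
qed

text \<open>The modulus of the Blaschke factor is the pseudohyperbolic distance. The identity behind
  the claim is that the squares of \<open>norm (1 - cnj w * v)\<close> and
  \<open>norm (v - w)\<close> differ by the product of the two squared weights. It turns bounds on
  Gram entries into separation of the points.\<close>

lemma norm_szego_gram_sq:
  assumes w: "w \<in> ball 0 1" and v: "v \<in> ball 0 1"
  shows "(norm (szego_gram w v))\<^sup>2 = 1 - (norm (blaschke w v))\<^sup>2"
proof -
  have nz: "norm (1 - cnj w * v) \<noteq> 0" using szego_denom_nonzero[OF w, of v] v by auto
  have "complex_of_real ((norm (1 - cnj w * v))\<^sup>2 - (norm (v - w))\<^sup>2)
      = complex_of_real ((1 - (norm w)\<^sup>2) * (1 - (norm v)\<^sup>2))"
    unfolding of_real_diff of_real_mult complex_norm_square of_real_1 by (simp add: algebra_simps)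
  then have *: "(norm (1 - cnj w * v))\<^sup>2 - (norm (v - w))\<^sup>2 = (1 - (norm w)\<^sup>2) * (1 - (norm v)\<^sup>2)"
    using of_real_eq_iff by blast
  have "(norm (szego_gram w v))\<^sup>2 = (1 - (norm w)\<^sup>2) * (1 - (norm v)\<^sup>2) / (norm (1 - cnj w * v))\<^sup>2"
    by (simp add: szego_gram_def szego_def norm_mult norm_divide power_mult_distrib power_divide
        szego_weight_sq[OF w] szego_weight_sq[OF v])
  also have "\<dots> = 1 - (norm (v - w))\<^sup>2 / (norm (1 - cnj w * v))\<^sup>2"
    using nz unfolding *[symmetric] by (simp add: field_simps)
  finally show ?thesis by (simp add: blaschke_def szego_def norm_mult norm_divide power_divide)
qed

lemma szego_comb_continuous:
  "(\<And>n. n \<in> F \<Longrightarrow> a n \<in> ball 0 1) \<Longrightarrow> continuous_on (cball 0 1) (szego_comb a F c)"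
  unfolding szego_comb_def by (intro continuous_intros szego_continuous)

lemma szego_comb_continuous_sphere:
  "(\<And>n. n \<in> F \<Longrightarrow> a n \<in> ball 0 1) \<Longrightarrow> continuous_on (sphere 0 1) (szego_comb a F c)"
  using szego_comb_continuous by (rule continuous_on_subset) auto

lemma szego_form_nonneg: "szego_form a F c \<ge> 0"
  by (simp add: szego_form_def)

lemma szego_form_gram:
  assumes a: "\<And>n. n \<in> F \<Longrightarrow> a n \<in> ball 0 1"
  shows "complex_of_real (szego_form a F c)
    = (\<Sum>m\<in>F. \<Sum>n\<in>F. c m * cnj (c n) * szego_gram (a m) (a n))"
proof -
  have sub: "sphere 0 1 \<subseteq> cball (0::complex) 1" by auto
  have "complex_of_real (szego_form a F c) = (\<Sum>m\<in>F. \<Sum>n\<in>F. c m * cnj (c n) *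
    (LINT z|circle_measure. of_real (szego_weight (a m)) * szego (a m) z
        * cnj (of_real (szego_weight (a n)) * szego (a n) z)))"
    unfolding szego_form_def szego_comb_def
    by (intro integral_norm_sum_square square_integrable_continuous continuous_intros
        continuous_on_subset[OF szego_continuous[OF a] sub])
  also have "\<dots> = (\<Sum>m\<in>F. \<Sum>n\<in>F. c m * cnj (c n) * szego_gram (a m) (a n))"
  proof (intro sum.cong refl)
    fix m n assume mn: "m \<in> F" "n \<in> F"
    have "(LINT z|circle_measure. of_real (szego_weight (a m)) * szego (a m) z
        * cnj (of_real (szego_weight (a n)) * szego (a n) z))
      = (LINT z|circle_measure. of_real (szego_weight (a m)) * of_real (szego_weight (a n))
          * (szego (a m) z * cnj (szego (a n) z)))"
      by (intro Bochner_Integration.integral_cong refl) simp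
    also have "\<dots> = szego_gram (a m) (a n)"
      unfolding szego_gram_def
      by (subst Bochner_Integration.integral_mult_right_zero, subst cauchy_szego)
        (intro szego_continuous szego_holomorphic a mn refl)+
    finally show "c m * cnj (c n) * (LINT z|circle_measure. of_real (szego_weight (a m)) * szego (a m) z
        * cnj (of_real (szego_weight (a n)) * szego (a n) z)) = c m * cnj (c n) * szego_gram (a m) (a n)"
      by simp
  qed
  finally show ?thesis .
qed

text \<open>Both claims come from \<open>(z - w) * cnj z = cnj (1 - cnj w * z)\<close> on the
  circle. The second converts a kernel into its own conjugate times a unimodular factor.\<close>

lemma blaschke_boundary:
  assumes w: "w \<in> ball 0 1" and z: "z \<in> sphere 0 1"
  shows "norm (blaschke w z) = 1" and "blaschke w z * cnj z * cnj (szego w z) = szego w z"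
proof -
  have zz: "z * cnj z = 1" using z by (simp add: complex_norm_square[symmetric])
  have eq: "(z - w) * cnj z = cnj (1 - cnj w * z)" using zz by (simp add: algebra_simps)
  have nz: "1 - cnj w * z \<noteq> 0" using szego_denom_nonzero[OF w] z by auto
  have "norm (z - w) = norm ((z - w) * cnj z)" using z by (simp add: norm_mult)
  also have "\<dots> = norm (1 - cnj w * z)" unfolding eq complex_mod_cnj ..
  finally show "norm (blaschke w z) = 1"
    using nz by (simp add: blaschke_def szego_def norm_divide norm_mult)
  have "blaschke w z * cnj z * cnj (szego w z) = ((z - w) * cnj z) * cnj (szego w z) * szego w z"
    by (simp add: blaschke_def)
  also have "((z - w) * cnj z) * cnj (szego w z) = 1"
    unfolding eq using nz by (simp add: szego_def flip: complex_cnj_mult)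
  finally show "blaschke w z * cnj z * cnj (szego w z) = szego w z" by simp
qed

text \<open>The functions \<open>k\<^sub>m \<Prod>\<^bsub>k\<noteq>m\<^esub> b\<^sub>k\<close>, suitably normalized, are biorthogonal to the Szego kernels
  \<open>k\<^sub>m\<close>, and on the circle they agree up to a common unimodular factor with the conjugates of the
  \<open>k\<^sub>m\<close>. Hence an upper bound of the Gram form yields a lower bound.\<close>

lemma szego_form_lower_bound:
  assumes fin: "finite F" and a: "\<And>n. n \<in> F \<Longrightarrow> a n \<in> ball 0 1"
    and \<delta>: "\<delta> > 0" "\<And>n. n \<in> F \<Longrightarrow> \<delta> \<le> (\<Prod>k\<in>F-{n}. norm (blaschke (a k) (a n)))"
    and \<mu>: "\<mu> > 0" "\<And>d. szego_form a F d \<le> \<mu> * (\<Sum>n\<in>F. (norm (d n))\<^sup>2)"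
  shows "\<delta>\<^sup>2 * (\<Sum>n\<in>F. (norm (c n))\<^sup>2) \<le> \<mu> * szego_form a F c"
proof -
  define P where "P n z = (\<Prod>k\<in>F-{n}. blaschke (a k) z)" for n z
  \<comment> \<open>\<open>P m\<close> vanishes at every other point \<open>a n\<close>, so this
    normalization makes \<open>g\<close> interpolate: its weighted value at \<open>a n\<close> is
    \<open>c n\<close>.\<close>
  define d where "d n = c n / P n (a n)" for n
  define g where "g z = (\<Sum>n\<in>F. d n * (of_real (szego_weight (a n)) * (P n z * szego (a n) z)))" for z
  define \<sigma> where "\<sigma> = (\<Sum>n\<in>F. (norm (c n))\<^sup>2)"
  have sub: "sphere 0 1 \<subseteq> cball (0::complex) 1" by auto
  have P\<delta>: "\<delta> \<le> norm (P n (a n))" if "n \<in> F" for n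
    using \<delta>(2)[OF that] by (simp add: P_def prod_norm)
  have Pcont: "continuous_on (cball 0 1) (P n)" for n
    unfolding P_def blaschke_def by (intro continuous_intros szego_continuous a) auto
  have Phol: "P n holomorphic_on ball 0 1" for n
    unfolding P_def blaschke_def by (intro holomorphic_intros szego_holomorphic a) auto
  have gcont: "continuous_on (cball 0 1) g"
    unfolding g_def by (intro continuous_intros Pcont szego_continuous a)
  have ghol: "g holomorphic_on ball 0 1"
    unfolding g_def by (intro holomorphic_intros Phol szego_holomorphic a)
  have val: "of_real (szego_weight (a n)) * g (a n) = c n" if n: "n \<in> F" for n
  proof -
    have "P m (a n) = 0" if "m \<in> F" "m \<noteq> n" for m
      using n that fin by (auto simp: P_def blaschke_def prod_zero_iff)
    then have "g (a n) = (\<Sum>m\<in>F. if m = n then d n * (of_real (szego_weight (a n)) * (P n (a n) * szego (a n) (a n))) else 0)"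
      unfolding g_def by (intro sum.cong) auto
    also have "\<dots> = d n * (of_real (szego_weight (a n)) * (P n (a n) * szego (a n) (a n)))"
      using fin n by simp
    finally have "of_real (szego_weight (a n)) * g (a n)
      = d n * P n (a n) * (of_real (szego_weight (a n)) * (of_real (szego_weight (a n)) * szego (a n) (a n)))"
      by (simp add: mult_ac)
    also have "\<dots> = d n * P n (a n)" by (simp only: szego_diag[OF a[OF n]] mult_1_right)
    also have "\<dots> = c n" using P\<delta>[OF n] \<delta>(1) by (auto simp: d_def)
    finally show ?thesis .
  qed
  have int: "integrable circle_measure (\<lambda>z. g z * cnj (szego (a n) z))" if "n \<in> F" for n
    using gcont szego_continuous[OF a[OF that]] sub
    by (intro integrable_circle_continuous continuous_intros) (auto intro: continuous_on_subset)
  have "(LINT z|circle_measure. g z * cnj (szego_comb a F c z))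
      = (LINT z|circle_measure. (\<Sum>n\<in>F. cnj (c n) * of_real (szego_weight (a n)) * (g z * cnj (szego (a n) z))))"
    by (intro Bochner_Integration.integral_cong refl)
       (simp add: szego_comb_def sum_distrib_left cnj_sum mult_ac)
  also have "\<dots> = (\<Sum>n\<in>F. cnj (c n) * of_real (szego_weight (a n)) * (LINT z|circle_measure. g z * cnj (szego (a n) z)))"
    by (simp add: Bochner_Integration.integral_sum int)
  also have "\<dots> = (\<Sum>n\<in>F. cnj (c n) * (of_real (szego_weight (a n)) * g (a n)))"
    by (intro sum.cong refl) (simp only: cauchy_szego[OF gcont ghol a] mult.assoc)
  also have "\<dots> = (\<Sum>n\<in>F. complex_of_real ((norm (c n))\<^sup>2))"
    by (intro sum.cong refl) (subst val, assumption, subst complex_norm_square, rule mult.commute)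
  also have "\<dots> = of_real \<sigma>" by (simp add: \<sigma>_def)
  \<comment> \<open>Biorthogonality in use: pairing with \<open>g\<close> recovers the square sum of
    the coefficients exactly, and the rest of the argument bounds this pairing.\<close>
  finally have pair: "(LINT z|circle_measure. g z * cnj (szego_comb a F c z)) = of_real \<sigma>" .
  \<comment> \<open>The full product \<open>B\<close> absorbs the missing factor of each
    \<open>P n\<close>, so on the circle \<open>g\<close> is the unimodular \<open>B * cnj z\<close>
    times the conjugate of a Szego combination. The assumed upper bound therefore applies to
    \<open>g\<close>.\<close>
  have norm_g: "norm (g z) = norm (szego_comb a F (\<lambda>n. cnj (d n)) z)" if z: "z \<in> sphere 0 1" for z
  proof -
    define B where "B = (\<Prod>k\<in>F. blaschke (a k) z)"
    have "P n z * szego (a n) z = B * cnj z * cnj (szego (a n) z)" if "n \<in> F" for n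
    proof -
      have "B = blaschke (a n) z * P n z"
        unfolding B_def P_def using fin that by (rule prod.remove)
      then show ?thesis using blaschke_boundary(2)[OF a[OF that] z]
        by (simp add: mult_ac)
    qed
    then have "g z = (\<Sum>n\<in>F. d n * (of_real (szego_weight (a n)) * (B * cnj z * cnj (szego (a n) z))))"
      unfolding g_def by (intro sum.cong) auto
    also have "\<dots> = B * cnj z * cnj (szego_comb a F (\<lambda>n. cnj (d n)) z)"
      by (simp add: szego_comb_def sum_distrib_left cnj_sum mult_ac)
    finally show ?thesis
      using blaschke_boundary(1)[OF a z] z by (simp add: norm_mult B_def flip: prod_norm)
  qed
  have "(LINT z|circle_measure. (norm (g z))\<^sup>2) = szego_form a F (\<lambda>n. cnj (d n))"
    unfolding szego_form_def by (intro Bochner_Integration.integral_cong refl) (simp add: norm_g)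
  also have "\<dots> \<le> \<mu> * (\<Sum>n\<in>F. (norm (cnj (d n)))\<^sup>2)" by (rule \<mu>(2))
  also have "\<dots> \<le> \<mu> * (\<Sum>n\<in>F. (norm (c n))\<^sup>2 / \<delta>\<^sup>2)"
  proof (intro mult_left_mono sum_mono)
    fix n assume n: "n \<in> F"
    have "norm (d n) \<le> norm (c n) / \<delta>"
      using P\<delta>[OF n] \<delta>(1) by (simp add: d_def norm_divide frac_le)
    then have "(norm (d n))\<^sup>2 \<le> (norm (c n) / \<delta>)\<^sup>2" by (rule power_mono) simp
    then show "(norm (cnj (d n)))\<^sup>2 \<le> (norm (c n))\<^sup>2 / \<delta>\<^sup>2" by (simp add: power_divide)
  qed (use \<mu> in auto)
  also have "\<dots> = \<mu> / \<delta>\<^sup>2 * \<sigma>" by (simp add: \<sigma>_def flip: sum_divide_distrib)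
  finally have G: "(LINT z|circle_measure. (norm (g z))\<^sup>2) \<le> \<mu> / \<delta>\<^sup>2 * \<sigma>" .
  \<comment> \<open>With this weight in the arithmetic-geometric inequality, which stands in for
    Cauchy-Schwarz, the share of \<open>g\<close> is at most \<sigma>/2 and is absorbed on the
    left.\<close>
  define t where "t = \<mu> / \<delta>\<^sup>2"
  have t: "t > 0" using \<mu> \<delta> by (simp add: t_def)
  have gs: "continuous_on (sphere 0 1) g" by (rule continuous_on_subset[OF gcont sub])
  note cs = szego_comb_continuous_sphere[of F a c, OF a]
  have "\<sigma> = norm (LINT z|circle_measure. g z * cnj (szego_comb a F c z))"
    unfolding pair using sum_nonneg[of F "\<lambda>n. (norm (c n))\<^sup>2"] by (simp flip: \<sigma>_def)
  also have "\<dots> \<le> (LINT z|circle_measure. norm (g z * cnj (szego_comb a F c z)))"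
    by (rule integral_norm_bound)
  also have "\<dots> \<le> (LINT z|circle_measure. t / 2 * (norm (szego_comb a F c z))\<^sup>2 + 1 / (2 * t) * (norm (g z))\<^sup>2)"
  proof (intro integral_mono integrable_circle_continuous continuous_intros gs cs)
    fix z
    let ?x = "norm (szego_comb a F c z)" and ?y = "norm (g z)"
    have "0 \<le> (t * ?x - ?y)\<^sup>2 / (2 * t)" using t by simp
    also have "\<dots> = t / 2 * ?x\<^sup>2 + 1 / (2 * t) * ?y\<^sup>2 - ?y * ?x"
      using t by (simp add: power2_eq_square field_simps)
    finally show "norm (g z * cnj (szego_comb a F c z)) \<le> t / 2 * ?x\<^sup>2 + 1 / (2 * t) * ?y\<^sup>2"
      by (simp add: norm_mult)
  qed (use t in auto)
  also have "\<dots> = t / 2 * szego_form a F c + 1 / (2 * t) * (LINT z|circle_measure. (norm (g z))\<^sup>2)"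
    unfolding szego_form_def
    using t by (subst Bochner_Integration.integral_add)
       (auto intro!: integrable_circle_continuous continuous_intros gs cs)
  also have "\<dots> \<le> t / 2 * szego_form a F c + 1 / (2 * t) * (t * \<sigma>)"
    using G t by (intro add_left_mono mult_left_mono) (simp_all flip: t_def)
  also have "\<dots> = t / 2 * szego_form a F c + \<sigma> / 2" using t by simp
  finally have "\<sigma> \<le> t * szego_form a F c" by simp
  then show ?thesis using \<delta>(1) by (simp add: t_def \<sigma>_def field_simps)
qed

section \<open>Upper bounds for the Szego form\<close>

lemma szego_form_crude_bound:
  assumes "finite F" "\<And>n. n \<in> F \<Longrightarrow> a n \<in> ball 0 1"
  shows "\<exists>L\<ge>0. \<forall>c. szego_form a F c \<le> L * (\<Sum>n\<in>F. (norm (c n))\<^sup>2)"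
proof (intro exI conjI allI)
  let ?L = "\<Sum>m\<in>F. \<Sum>n\<in>F. norm (szego_gram (a m) (a n))"
  show "0 \<le> ?L" by (intro sum_nonneg) auto
  fix c :: "nat \<Rightarrow> complex"
  let ?\<sigma> = "\<Sum>n\<in>F. (norm (c n))\<^sup>2"
  have sq: "(norm (c n))\<^sup>2 \<le> ?\<sigma>" if "n \<in> F" for n
    using that assms(1) by (intro member_le_sum) auto
  have "szego_form a F c = norm (complex_of_real (szego_form a F c))"
    using szego_form_nonneg[of a F c] by simp
  also have "\<dots> = norm (\<Sum>m\<in>F. \<Sum>n\<in>F. c m * cnj (c n) * szego_gram (a m) (a n))"
    by (simp only: szego_form_gram[OF assms(2)])
  also have "\<dots> \<le> (\<Sum>m\<in>F. \<Sum>n\<in>F. norm (c m * cnj (c n) * szego_gram (a m) (a n)))"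
    by (rule order_trans[OF norm_sum]) (intro sum_mono norm_sum)
  also have "\<dots> \<le> (\<Sum>m\<in>F. \<Sum>n\<in>F. norm (szego_gram (a m) (a n)) * ?\<sigma>)"
  proof (intro sum_mono)
    fix m n assume mn: "m \<in> F" "n \<in> F"
    have "norm (c m) * norm (c n) \<le> ?\<sigma>"
      using sum_squares_bound[of "norm (c m)" "norm (c n)"] sq[OF mn(1)] sq[OF mn(2)] by simp
    from mult_left_mono[OF this norm_ge_zero[of "szego_gram (a m) (a n)"]]
    show "norm (c m * cnj (c n) * szego_gram (a m) (a n)) \<le> norm (szego_gram (a m) (a n)) * ?\<sigma>"
      by (simp add: norm_mult mult_ac)
  qed
  also have "\<dots> = ?L * ?\<sigma>" by (simp add: sum_distrib_right)
  finally show "szego_form a F c \<le> ?L * ?\<sigma>" .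
qed

lemma sum_norm_mult_sq_le:
  assumes "\<And>n. n \<in> F \<Longrightarrow> norm (w n) \<le> (\<eta>::real)"
  shows "(\<Sum>n\<in>F. (norm (c n * w n :: complex))\<^sup>2) \<le> \<eta>\<^sup>2 * (\<Sum>n\<in>F. (norm (c n))\<^sup>2)"
proof -
  have "(norm (c n * w n))\<^sup>2 \<le> \<eta>\<^sup>2 * (norm (c n))\<^sup>2" if "n \<in> F" for n
    using mult_left_mono[OF power_mono[OF assms[OF that], of 2], of "(norm (c n))\<^sup>2"]
    by (simp add: norm_mult power_mult_distrib mult.commute)
  then show ?thesis unfolding sum_distrib_left by (rule sum_mono)
qed

text \<open>Substituting the hypothesis into itself sums a geometric series with ratio
  \<open>\<eta>\<^sup>2\<close>. The crude constant \<open>L\<close> may depend on \<open>F\<close>,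
  but after \<open>k\<close> substitutions it carries the factor
  \<open>(\<eta>\<^sup>2) ^ k\<close>, so the limit bound is free of it.\<close>

lemma szego_form_upper_bound:
  assumes fin: "finite F" and a: "\<And>n. n \<in> F \<Longrightarrow> a n \<in> ball 0 1"
    and w: "\<And>n. n \<in> F \<Longrightarrow> norm (w n) \<le> \<eta>" "0 \<le> \<eta>" "\<eta> < 1"
    and C: "\<And>c. szego_form a F c - szego_form a F (\<lambda>n. c n * w n) \<le> C * (\<Sum>n\<in>F. (norm (c n))\<^sup>2)"
      "C \<ge> 0"
  shows "szego_form a F c \<le> C / (1 - \<eta>\<^sup>2) * (\<Sum>n\<in>F. (norm (c n))\<^sup>2)"
proof -
  obtain L where L: "L \<ge> 0" "\<And>c. szego_form a F c \<le> L * (\<Sum>n\<in>F. (norm (c n))\<^sup>2)"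
    using szego_form_crude_bound[OF fin, of a] a by blast
  have \<eta>: "\<eta>\<^sup>2 < 1" using w(2,3) by (simp add: power_less_one_iff)
  have *: "szego_form a F c \<le> (C / (1 - \<eta>\<^sup>2) + L * (\<eta>\<^sup>2) ^ k) * (\<Sum>n\<in>F. (norm (c n))\<^sup>2)" for k c
  proof (induction k arbitrary: c)
    case 0
    have "L * (\<Sum>n\<in>F. (norm (c n))\<^sup>2) \<le> (C / (1 - \<eta>\<^sup>2) + L) * (\<Sum>n\<in>F. (norm (c n))\<^sup>2)"
      using C(2) \<eta> by (intro mult_right_mono sum_nonneg) auto
    with L(2)[of c] show ?case by simp
  next
    case (Suc k)
    let ?\<sigma> = "\<Sum>n\<in>F. (norm (c n))\<^sup>2"
    have "szego_form a F c \<le> C * ?\<sigma> + szego_form a F (\<lambda>n. c n * w n)" using C(1)[of c] by simp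
    also have "\<dots> \<le> C * ?\<sigma> + (C / (1 - \<eta>\<^sup>2) + L * (\<eta>\<^sup>2) ^ k) * (\<Sum>n\<in>F. (norm (c n * w n))\<^sup>2)"
      by (intro add_left_mono Suc)
    also have "\<dots> \<le> C * ?\<sigma> + (C / (1 - \<eta>\<^sup>2) + L * (\<eta>\<^sup>2) ^ k) * (\<eta>\<^sup>2 * ?\<sigma>)"
      using C(2) L(1) \<eta> by (intro add_left_mono mult_left_mono sum_norm_mult_sq_le w) auto
    also have "\<dots> = (C / (1 - \<eta>\<^sup>2) + L * (\<eta>\<^sup>2) ^ Suc k) * ?\<sigma>"
      using \<eta> by (simp add: field_simps)
    finally show ?case .
  qed
  have "(\<lambda>k. (C / (1 - \<eta>\<^sup>2) + L * (\<eta>\<^sup>2) ^ k) * (\<Sum>n\<in>F. (norm (c n))\<^sup>2))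
    \<longlonglongrightarrow> (C / (1 - \<eta>\<^sup>2) + L * 0) * (\<Sum>n\<in>F. (norm (c n))\<^sup>2)"
    using \<eta> by (intro tendsto_intros LIMSEQ_power_zero) simp
  then show ?thesis using * by (intro LIMSEQ_le_const) auto
qed

lemma norm_add_sq_le:
  fixes x y :: "'a::real_normed_vector"
  assumes "\<tau> > 0"
  shows "(norm (x + y))\<^sup>2 \<le> (1 + \<tau>) * (norm x)\<^sup>2 + (1 + 1 / \<tau>) * (norm y)\<^sup>2"
proof -
  have "(norm (x + y))\<^sup>2 \<le> (norm x + norm y)\<^sup>2" by (intro power_mono norm_triangle_ineq) auto
  also have "\<dots> = (1 + \<tau>) * (norm x)\<^sup>2 + (1 + 1 / \<tau>) * (norm y)\<^sup>2 - (\<tau> * norm x - norm y)\<^sup>2 / \<tau>"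
    using assms by (simp add: power2_eq_square field_simps)
  also have "\<dots> \<le> (1 + \<tau>) * (norm x)\<^sup>2 + (1 + 1 / \<tau>) * (norm y)\<^sup>2" using assms by simp
  finally show ?thesis .
qed

text \<open>If the multipliers are nearly the constant \<open>u\<close>, they act on the form almost
  like multiplication by \<open>u\<close>. Writing \<open>w n\<close> as \<open>u\<close> plus a
  remainder, the remainder has coefficients at most \<epsilon> times the old ones and is controlled
  by \<mu>; \<tau> distributes the cross term.\<close>

lemma szego_form_mult_le:
  assumes a: "\<And>n. n \<in> F \<Longrightarrow> a n \<in> ball 0 1"
    and u: "norm u \<le> \<eta>" and w: "\<And>n. n \<in> F \<Longrightarrow> norm (w n - u) \<le> \<epsilon>"
    and \<mu>: "\<mu> \<ge> 0" "\<And>d. szego_form a F d \<le> \<mu> * (\<Sum>n\<in>F. (norm (d n))\<^sup>2)" and \<tau>: "\<tau> > 0"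
  shows "szego_form a F (\<lambda>n. c n * w n)
    \<le> (1 + \<tau>) * \<eta>\<^sup>2 * szego_form a F c + (1 + 1 / \<tau>) * \<mu> * \<epsilon>\<^sup>2 * (\<Sum>n\<in>F. (norm (c n))\<^sup>2)"
proof -
  define d where "d n = c n * (w n - u)" for n
  note cs = szego_comb_continuous_sphere[of F a, OF a]
  have split: "szego_comb a F (\<lambda>n. c n * w n) z = u * szego_comb a F c z + szego_comb a F d z" for z
    by (simp add: szego_comb_def d_def sum_distrib_left flip: sum.distrib) (simp add: algebra_simps)
  have "szego_form a F (\<lambda>n. c n * w n)
     \<le> (LINT z|circle_measure. (1 + \<tau>) * \<eta>\<^sup>2 * (norm (szego_comb a F c z))\<^sup>2
          + (1 + 1 / \<tau>) * (norm (szego_comb a F d z))\<^sup>2)"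
    unfolding szego_form_def
  proof (intro integral_mono integrable_circle_continuous continuous_intros cs)
    fix z
    have "(norm (u * szego_comb a F c z))\<^sup>2 \<le> \<eta>\<^sup>2 * (norm (szego_comb a F c z))\<^sup>2"
      using power_mono[OF u, of 2] by (simp add: norm_mult power_mult_distrib mult_right_mono)
    then have "(1 + \<tau>) * (norm (u * szego_comb a F c z))\<^sup>2 \<le> (1 + \<tau>) * (\<eta>\<^sup>2 * (norm (szego_comb a F c z))\<^sup>2)"
      using \<tau> by (intro mult_left_mono) auto
    then show "(norm (szego_comb a F (\<lambda>n. c n * w n) z))\<^sup>2 \<le> (1 + \<tau>) * \<eta>\<^sup>2 * (norm (szego_comb a F c z))\<^sup>2
          + (1 + 1 / \<tau>) * (norm (szego_comb a F d z))\<^sup>2"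
      unfolding split using norm_add_sq_le[OF \<tau>, of "u * szego_comb a F c z" "szego_comb a F d z"]
      by (simp add: mult.assoc)
  qed auto
  also have "\<dots> = (1 + \<tau>) * \<eta>\<^sup>2 * szego_form a F c + (1 + 1 / \<tau>) * szego_form a F d"
    unfolding szego_form_def
    by (subst Bochner_Integration.integral_add)
       (auto intro!: integrable_circle_continuous continuous_intros cs)
  also have "\<dots> \<le> (1 + \<tau>) * \<eta>\<^sup>2 * szego_form a F c
      + (1 + 1 / \<tau>) * (\<mu> * (\<epsilon>\<^sup>2 * (\<Sum>n\<in>F. (norm (c n))\<^sup>2)))"
  proof (intro add_left_mono mult_left_mono)
    show "szego_form a F d \<le> \<mu> * (\<epsilon>\<^sup>2 * (\<Sum>n\<in>F. (norm (c n))\<^sup>2))"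
      by (rule order_trans[OF \<mu>(2)]) (unfold d_def, intro mult_left_mono sum_norm_mult_sq_le w \<mu>(1))
  qed (use \<tau> in simp)
  finally show ?thesis by (simp add: mult.assoc)
qed

section \<open>Linear combinations of model kernels\<close>

text \<open>Existence of the separate limits matters: at other points \<open>bdry\<close> takes its
  default value and need not be additive.\<close>

lemma bdry_sum:
  assumes "\<And>n. n \<in> F \<Longrightarrow> z \<in> radial_limit_set (h n)"
  shows "bdry (\<lambda>z. \<Sum>n\<in>F. c n * h n z) z = (\<Sum>n\<in>F. c n * bdry (h n) z)"
proof -
  have "((\<lambda>r::real. h n (of_real r * z)) \<longlongrightarrow> bdry (h n) z) (at_left 1)" if n: "n \<in> F" for n
  proof -
    from assms[OF n] obtain l where "((\<lambda>r::real. h n (of_real r * z)) \<longlongrightarrow> l) (at_left 1)"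
      by (auto simp: radial_limit_set_def)
    with bdry_eq[OF this] show ?thesis by simp
  qed
  then have "((\<lambda>r::real. \<Sum>n\<in>F. c n * h n (of_real r * z)) \<longlongrightarrow> (\<Sum>n\<in>F. c n * bdry (h n) z)) (at_left 1)"
    by (intro tendsto_intros)
  then show ?thesis by (rule bdry_eq)
qed

lemma hinner_cnj: "cnj (hinner f g) = hinner g f"
  unfolding hinner_def by (simp add: mult.commute flip: Bochner_Integration.integral_cnj)

lemma hnorm_sq: "complex_of_real ((hnorm f)\<^sup>2) = hinner f f"
proof -
  have "(LINT z|circle_measure. (norm (bdry f z))\<^sup>2) \<ge> 0" by simp
  then have "complex_of_real ((hnorm f)\<^sup>2) = (LINT z|circle_measure. complex_of_real ((norm (bdry f z))\<^sup>2))"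
    by (simp add: hnorm_def integral_complex_of_real del: of_real_power)
  then show ?thesis by (simp only: hinner_def complex_norm_square)
qed

text \<open>Linearity of \<open>bdry\<close> holds off a finite union of null sets. Only the
  summands on the left must have radial limits, since \<open>bdry g\<close> enters as one fixed
  square integrable factor.\<close>

lemma hinner_sum_left:
  assumes fin: "finite F" and h: "\<And>n. n \<in> F \<Longrightarrow> h n \<in> hardy2"
    and lim: "\<And>n. n \<in> F \<Longrightarrow> AE z in circle_measure. z \<in> radial_limit_set (h n)"
    and g: "g \<in> hardy2"
  shows "hinner (\<lambda>z. \<Sum>n\<in>F. c n * h n z) g = (\<Sum>n\<in>F. c n * hinner (h n) g)"
proof -
  have cont: "continuous_on (ball 0 1) f" if "f \<in> hardy2" for f
    using that by (auto simp: hardy2_def holomorphic_on_imp_continuous_on)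
  have int: "integrable circle_measure (\<lambda>z. bdry (h n) z * cnj (bdry g z))" if "n \<in> F" for n
    by (intro square_integrable_mult_cnj square_integrable_hardy2 h g that)
  have m1: "bdry (\<lambda>z. \<Sum>n\<in>F. c n * h n z) \<in> borel_measurable circle_measure"
    by (intro bdry_measurable continuous_intros cont h)
  have m2: "(\<lambda>z. cnj (bdry g z)) \<in> borel_measurable circle_measure"
    by (rule borel_measurable_continuous_on[OF _ bdry_measurable[OF cont[OF g]]])
      (auto intro!: continuous_intros)
  have "AE z in circle_measure. \<forall>n\<in>F. z \<in> radial_limit_set (h n)"
    using lim fin by (simp add: AE_finite_allI)
  with AE_space have "AE z in circle_measure. bdry (\<lambda>z. \<Sum>n\<in>F. c n * h n z) z * cnj (bdry g z)
      = (\<Sum>n\<in>F. c n * (bdry (h n) z * cnj (bdry g z)))"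
  proof eventually_elim
    case (elim z)
    then show ?case
      by (subst bdry_sum) (auto simp: sum_distrib_right mult.assoc)
  qed
  then have "hinner (\<lambda>z. \<Sum>n\<in>F. c n * h n z) g
      = (LINT z|circle_measure. (\<Sum>n\<in>F. c n * (bdry (h n) z * cnj (bdry g z))))"
    unfolding hinner_def
    by (intro integral_cong_AE borel_measurable_times m1 m2 borel_measurable_sum
        borel_measurable_integrable integrable_mult_right int)
  also have "\<dots> = (\<Sum>n\<in>F. c n * hinner (h n) g)"
    by (simp add: Bochner_Integration.integral_sum int hinner_def)
  finally show ?thesis .
qed

section \<open>Linear combinations in the Hardy and model spaces\<close>

lemma hardy2_add:
  assumes "f \<in> hardy2" "g \<in> hardy2"
  shows "(\<lambda>z. f z + g z) \<in> hardy2"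
proof -
  from assms obtain C D where hol: "f holomorphic_on ball 0 1" "g holomorphic_on ball 0 1"
    and C: "\<And>r. r \<in> {0..<1} \<Longrightarrow> (LINT z|circle_measure. (norm (f (of_real r * z)))\<^sup>2) \<le> C"
    and D: "\<And>r. r \<in> {0..<1} \<Longrightarrow> (LINT z|circle_measure. (norm (g (of_real r * z)))\<^sup>2) \<le> D"
    unfolding hardy2_def by blast
  have "(LINT z|circle_measure. (norm (f (of_real r * z) + g (of_real r * z)))\<^sup>2) \<le> 2 * C + 2 * D"
    if r: "r \<in> {0..<1}" for r
  proof -
    have sub: "sphere 0 1 \<subseteq> cball (0::complex) 1" by auto
    note c = hol[THEN holomorphic_on_imp_continuous_on, THEN continuous_on_dilation, OF r,
        THEN continuous_on_subset, OF sub]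
    have "(LINT z|circle_measure. (norm (f (of_real r * z) + g (of_real r * z)))\<^sup>2)
       \<le> (LINT z|circle_measure. 2 * (norm (f (of_real r * z)))\<^sup>2 + 2 * (norm (g (of_real r * z)))\<^sup>2)"
      by (intro integral_mono integrable_circle_continuous continuous_intros c)
         (use norm_add_sq_le[of 1] in simp)
    also have "\<dots> = 2 * (LINT z|circle_measure. (norm (f (of_real r * z)))\<^sup>2)
        + 2 * (LINT z|circle_measure. (norm (g (of_real r * z)))\<^sup>2)"
      by (subst Bochner_Integration.integral_add)
         (auto intro!: integrable_circle_continuous continuous_intros c)
    finally show ?thesis using C[OF r] D[OF r] by simp
  qed
  moreover have "(\<lambda>z. f z + g z) holomorphic_on ball 0 1" by (intro holomorphic_intros hol)
  ultimately show ?thesis unfolding hardy2_def by blast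
qed

lemma hardy2_sum:
  assumes "finite F" "\<And>n. n \<in> F \<Longrightarrow> h n \<in> hardy2"
  shows "(\<lambda>z. \<Sum>n\<in>F. c n * h n z) \<in> hardy2"
  using assms
proof (induction F rule: finite_induct)
  case empty
  show ?case by (intro bounded_imp_hardy2) (auto simp: image_constant_conv)
next
  case (insert n F)
  have "(\<lambda>z. c n * h n z) \<in> hardy2"
    by (rule hardy2_mult_bounded) (auto intro: insert.prems simp: image_constant_conv)
  from hardy2_add[OF this insert.IH] insert show ?case by simp
qed

text \<open>This admits finite combinations of kernels as test functions in the Bessel inequality,
  which quantifies over the model space only.\<close>

lemma model_space_sum:
  assumes \<Theta>: "inner_function \<Theta>" and fin: "finite F" and h: "\<And>n. n \<in> F \<Longrightarrow> h n \<in> model_space \<Theta>"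
    and lim: "\<And>n. n \<in> F \<Longrightarrow> AE z in circle_measure. z \<in> radial_limit_set (h n)"
  shows "(\<lambda>z. \<Sum>n\<in>F. c n * h n z) \<in> model_space \<Theta>"
proof -
  have h2: "h n \<in> hardy2" if "n \<in> F" for n using h[OF that] by (simp add: model_space_def)
  have "hinner (\<lambda>z. \<Sum>n\<in>F. c n * h n z) (\<lambda>z. \<Theta> z * g z) = 0" if g: "g \<in> hardy2" for g
  proof -
    have "(\<lambda>z. \<Theta> z * g z) \<in> hardy2"
      using \<Theta> g by (intro hardy2_mult_bounded) (auto simp: inner_function_def)
    then have "hinner (\<lambda>z. \<Sum>n\<in>F. c n * h n z) (\<lambda>z. \<Theta> z * g z)
        = (\<Sum>n\<in>F. c n * hinner (h n) (\<lambda>z. \<Theta> z * g z))"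
      by (intro hinner_sum_left fin h2 lim)
    also have "\<dots> = 0" using h g by (intro sum.neutral) (auto simp: model_space_def)
    finally show ?thesis .
  qed
  with hardy2_sum[OF fin h2] show ?thesis by (simp add: model_space_def)
qed

lemma model_kernel_hardy2:
  assumes \<Theta>: "inner_function \<Theta>" and w: "w \<in> ball 0 1"
  shows "model_kernel \<Theta> w \<in> hardy2"
proof -
  from \<Theta> obtain B where hol: "\<Theta> holomorphic_on ball 0 1"
    and B: "\<And>z. z \<in> ball 0 1 \<Longrightarrow> norm (\<Theta> z) \<le> B"
    unfolding inner_function_def bounded_iff by blast
  have "norm (1 - cnj (\<Theta> w) * \<Theta> z) \<le> 1 + norm (\<Theta> w) * B" if "z \<in> ball 0 1" for z
    using norm_triangle_ineq4[of 1 "cnj (\<Theta> w) * \<Theta> z"] mult_left_mono[OF B[OF that] norm_ge_zero[of "\<Theta> w"]]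
    by (simp add: norm_mult)
  then have "bounded ((\<lambda>z. 1 - cnj (\<Theta> w) * \<Theta> z) ` ball 0 1)"
    unfolding bounded_iff by blast
  moreover have "szego w \<in> hardy2"
  proof (rule bounded_imp_hardy2)
    have "bounded (szego w ` cball 0 1)"
      by (intro compact_imp_bounded compact_continuous_image szego_continuous w) simp
    then show "bounded (szego w ` ball 0 1)" by (rule bounded_subset) auto
  qed (rule szego_holomorphic[OF w])
  ultimately have "(\<lambda>z. (1 - cnj (\<Theta> w) * \<Theta> z) * szego w z) \<in> hardy2"
    by (intro hardy2_mult_bounded holomorphic_intros hol)
  then show ?thesis by (simp add: model_kernel_def[abs_def] szego_def)
qed

text \<open>The diagonal case of \<open>hinner_model_kernel\<close> gives the norm of a kernel as
  \<open>sqrt (1 - (norm (\<Theta> u))\<^sup>2) / szego_weight u\<close>. Dividing by the norms puts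
  the Szego weights into \<open>szego_gram\<close> and leaves the two square roots in the
  denominator.\<close>

lemma hinner_normalized_kernel:
  assumes \<Theta>: "inner_function \<Theta>"
    and w: "w \<in> ball 0 1" "norm (\<Theta> w) < 1" and v: "v \<in> ball 0 1" "norm (\<Theta> v) < 1"
  shows "hinner (normalized_kernel \<Theta> w) (normalized_kernel \<Theta> v) =
     (1 - cnj (\<Theta> w) * \<Theta> v) * szego_gram w v
       / (of_real (sqrt (1 - (norm (\<Theta> w))\<^sup>2)) * of_real (sqrt (1 - (norm (\<Theta> v))\<^sup>2)))"
proof -
  have hnorm: "hnorm (model_kernel \<Theta> u) = sqrt (1 - (norm (\<Theta> u))\<^sup>2) / szego_weight u"
    if u: "u \<in> ball 0 1" "norm (\<Theta> u) < 1" for u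
  proof -
    have "complex_of_real ((hnorm (model_kernel \<Theta> u))\<^sup>2 * (szego_weight u)\<^sup>2)
       = (1 - cnj (\<Theta> u) * \<Theta> u) * (of_real (szego_weight u) * (of_real (szego_weight u) * szego u u))"
      unfolding of_real_mult hnorm_sq hinner_model_kernel[OF \<Theta> u(1) u(1)]
      by (simp add: power2_eq_square)
    also have "\<dots> = complex_of_real (1 - (norm (\<Theta> u))\<^sup>2)"
      by (simp only: szego_diag[OF u(1)] of_real_diff complex_norm_square)
         (simp add: mult.commute)
    finally have "(hnorm (model_kernel \<Theta> u) * szego_weight u)\<^sup>2 = 1 - (norm (\<Theta> u))\<^sup>2"
      unfolding of_real_eq_iff power_mult_distrib .
    moreover have "hnorm (model_kernel \<Theta> u) * szego_weight u \<ge> 0"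
      using szego_weight_pos[OF u(1)] by (simp add: hnorm_def)
    ultimately have "sqrt (1 - (norm (\<Theta> u))\<^sup>2) = hnorm (model_kernel \<Theta> u) * szego_weight u"
      by (rule real_sqrt_unique)
    then show ?thesis using szego_weight_pos[OF u(1)] by simp
  qed
  have scale: "hinner (\<lambda>z. c * model_kernel \<Theta> u z) g = c * hinner (model_kernel \<Theta> u) g"
    if u: "u \<in> ball 0 1" and g: "g \<in> hardy2" for c u g
  proof -
    have "AE z in circle_measure. z \<in> radial_limit_set (model_kernel \<Theta> u)"
      using AE_space inner_function_bdry(1)[OF \<Theta>]
    proof eventually_elim
      case (elim z)
      with model_kernel_radial_limit[OF elim(2) u] show ?case by (auto simp: radial_limit_set_def)
    qed
    from hinner_sum_left[of "{0::nat}" "\<lambda>_. model_kernel \<Theta> u" g "\<lambda>_. c", OF _ model_kernel_hardy2[OF \<Theta> u] this g]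
    show ?thesis by simp
  qed
  have mem: "(\<lambda>z. c * model_kernel \<Theta> u z) \<in> hardy2" if "u \<in> ball 0 1" for c u
    using hardy2_sum[of "{0::nat}" "\<lambda>_. model_kernel \<Theta> u" "\<lambda>_. c"] model_kernel_hardy2[OF \<Theta> that] by simp
  define N where "N u = complex_of_real (1 / hnorm (model_kernel \<Theta> u))" for u
  have nk: "normalized_kernel \<Theta> u = (\<lambda>z. N u * model_kernel \<Theta> u z)" for u
    by (simp add: fun_eq_iff normalized_kernel_def N_def)
  have "hinner (normalized_kernel \<Theta> w) (normalized_kernel \<Theta> v)
      = N w * hinner (model_kernel \<Theta> w) (\<lambda>z. N v * model_kernel \<Theta> v z)"
    unfolding nk by (intro scale mem w v)
  \<comment> \<open>Homogeneity is known in the left argument only, so the right one is reached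
    through conjugate symmetry; the constant \<open>N v\<close> is real and survives
    conjugation.\<close>
  also have "hinner (model_kernel \<Theta> w) (\<lambda>z. N v * model_kernel \<Theta> v z)
      = cnj (N v * hinner (model_kernel \<Theta> v) (model_kernel \<Theta> w))"
    unfolding scale[OF v(1) model_kernel_hardy2[OF \<Theta> w(1)], symmetric] by (rule hinner_cnj[symmetric])
  also have "\<dots> = N v * hinner (model_kernel \<Theta> w) (model_kernel \<Theta> v)"
    by (simp add: hinner_cnj N_def)
  finally show ?thesis
    using szego_weight_pos[OF w(1)] szego_weight_pos[OF v(1)]
    by (simp add: N_def hnorm[OF w] hnorm[OF v] hinner_model_kernel[OF \<Theta> w(1) v(1)] szego_gram_def)
qed

lemma normalized_kernel_radial_limit:
  assumes \<Theta>: "inner_function \<Theta>" and w: "w \<in> ball 0 1"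
  shows "AE z in circle_measure. z \<in> radial_limit_set (normalized_kernel \<Theta> w)"
  using AE_space inner_function_bdry(1)[OF \<Theta>]
proof eventually_elim
  case (elim z)
  have "((\<lambda>r::real. normalized_kernel \<Theta> w (of_real r * z)) \<longlongrightarrow>
     (1 - cnj (\<Theta> w) * bdry \<Theta> z) * szego w z * (1 / of_real (hnorm (model_kernel \<Theta> w)))) (at_left 1)"
    unfolding normalized_kernel_def divide_inverse[of "model_kernel _ _ _"] inverse_eq_divide
    by (intro tendsto_mult model_kernel_radial_limit[OF elim(2) w] tendsto_const)
  with elim show ?case by (auto simp: radial_limit_set_def)
qed

section \<open>Separated classes\<close>

function greedy_colour :: "(nat \<Rightarrow> nat \<Rightarrow> bool) \<Rightarrow> nat \<Rightarrow> nat" where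
  "greedy_colour R n = (LEAST k. \<forall>m\<in>{..<n}. R n m \<longrightarrow> greedy_colour R m \<noteq> k)"
  by pat_completeness auto
termination by (relation "Wellfounded.measure snd") auto

declare greedy_colour.simps [simp del]

text \<open>Each point has at most \<open>K\<close> earlier neighbours, so one of the
  \<open>K + 1\<close> colours is still free when its turn comes. The degree is bounded through
  finite sets \<open>G\<close> because \<open>card\<close> of an infinite set is 0.\<close>

lemma bounded_degree_colouring:
  fixes R :: "nat \<Rightarrow> nat \<Rightarrow> bool"
  assumes sym: "\<And>m n. R m n \<Longrightarrow> R n m"
    and deg: "\<And>n G. finite G \<Longrightarrow> (\<forall>m\<in>G. R n m) \<Longrightarrow> card G \<le> K"
  shows "\<exists>\<phi>::nat \<Rightarrow> nat. (\<forall>n. \<phi> n \<le> K) \<and> (\<forall>m n. m \<noteq> n \<longrightarrow> R m n \<longrightarrow> \<phi> m \<noteq> \<phi> n)"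
proof (intro exI[of _ "greedy_colour R"] conjI allI impI)
  have free: "\<exists>k\<le>K. \<forall>m\<in>{..<n}. R n m \<longrightarrow> greedy_colour R m \<noteq> k" for n
  proof (rule ccontr)
    assume "\<not> ?thesis"
    then have "\<forall>k\<le>K. \<exists>m\<in>{..<n}. R n m \<and> greedy_colour R m = k" by simp
    then have "{..K} \<subseteq> greedy_colour R ` {m\<in>{..<n}. R n m}" by (auto simp: image_iff)
    then have "card {..K} \<le> card (greedy_colour R ` {m\<in>{..<n}. R n m})"
      by (rule card_mono[rotated]) simp
    also have "\<dots> \<le> card {m\<in>{..<n}. R n m}" by (rule card_image_le) simp
    also have "\<dots> \<le> K" by (rule deg[of _ n]) auto
    finally show False by simp
  qed
  show "greedy_colour R n \<le> K" for n
    proof -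
    obtain k where "k \<le> K" "\<forall>m\<in>{..<n}. R n m \<longrightarrow> greedy_colour R m \<noteq> k" using free[of n] by (elim exE conjE)
    from Least_le[of "\<lambda>k. \<forall>m\<in>{..<n}. R n m \<longrightarrow> greedy_colour R m \<noteq> k", OF this(2)] this(1)
    show ?thesis by (simp add: greedy_colour.simps[of R n])
  qed
  have less: "greedy_colour R m \<noteq> greedy_colour R n" if "m < n" "R n m" for m n
  proof -
    obtain k where "\<forall>m\<in>{..<n}. R n m \<longrightarrow> greedy_colour R m \<noteq> k" using free[of n] by (elim exE conjE)
    from LeastI[of "\<lambda>k. \<forall>m\<in>{..<n}. R n m \<longrightarrow> greedy_colour R m \<noteq> k", OF this]
    have "\<forall>m\<in>{..<n}. R n m \<longrightarrow> greedy_colour R m \<noteq> greedy_colour R n"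
      by (simp add: greedy_colour.simps[of R n])
    with that show ?thesis by blast
  qed
  show "greedy_colour R m \<noteq> greedy_colour R n" if "m \<noteq> n" "R m n" for m n
    using less[of m n] less[of n m] that sym by (metis linorder_neqE_nat)
qed

text \<open>The restriction to \<open>x \<le> 1/2\<close> is the source of the separation threshold
  1/2 for squared Gram entries.\<close>

lemma exp_le_one_minus:
  assumes "0 \<le> x" "x \<le> (1/2::real)"
  shows "exp (-2 * x) \<le> 1 - x"
proof -
  have "2 * x\<^sup>2 \<le> x" using assms mult_left_mono[of "2 * x" 1 x] by (simp add: power2_eq_square)
  with ln_one_minus_pos_lower_bound[OF assms] have "-2 * x \<le> ln (1 - x)" by simp
  then show ?thesis using assms by (simp add: ln_ge_iff)
qed

lemma norm_szego_gram_commute: "norm (szego_gram w v) = norm (szego_gram v w)"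
  by (simp add: szego_gram_def norm_mult mult.commute flip: cnj_szego[of v w])

text \<open>The squared Blaschke factor is 1 minus the squared Gram entry, hence at least the
  exponential of minus twice that entry. Taking square roots and multiplying moves the row sum into
  the exponent.\<close>

lemma blaschke_prod_lower_bound:
  assumes fin: "finite F" and n: "n \<in> F" and a: "\<And>k. k \<in> F \<Longrightarrow> a k \<in> ball 0 1"
    and sep: "\<And>k. k \<in> F - {n} \<Longrightarrow> (norm (szego_gram (a n) (a k)))\<^sup>2 \<le> 1 / 2"
    and M: "(\<Sum>k\<in>F. (norm (szego_gram (a n) (a k)))\<^sup>2) \<le> M"
  shows "exp (- M) \<le> (\<Prod>k\<in>F-{n}. norm (blaschke (a k) (a n)))"
proof -
  have "exp (- M) \<le> exp (\<Sum>k\<in>F-{n}. - (norm (szego_gram (a n) (a k)))\<^sup>2)"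
    using M sum_mono2[of F "F - {n}" "\<lambda>k. (norm (szego_gram (a n) (a k)))\<^sup>2"] fin
    by (simp add: sum_negf)
  also have "\<dots> = (\<Prod>k\<in>F-{n}. exp (- (norm (szego_gram (a n) (a k)))\<^sup>2))"
    using fin by (simp add: exp_sum)
  also have "\<dots> \<le> (\<Prod>k\<in>F-{n}. norm (blaschke (a k) (a n)))"
  proof (intro prod_mono conjI)
    fix k assume k: "k \<in> F - {n}"
    let ?x = "(norm (szego_gram (a n) (a k)))\<^sup>2"
    have "(exp (- ?x))\<^sup>2 = exp (-2 * ?x)" by (simp flip: exp_double)
    also have "\<dots> \<le> 1 - ?x" by (intro exp_le_one_minus sep k) simp
    also have "\<dots> = (norm (blaschke (a k) (a n)))\<^sup>2"
      using norm_szego_gram_sq[of "a k" "a n"] a n k by (simp add: norm_szego_gram_commute)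
    finally show "exp (- ?x) \<le> norm (blaschke (a k) (a n))"
      by (rule power2_le_imp_le) simp
  qed simp
  finally show ?thesis .
qed

section \<open>Bessel sequences of model kernels\<close>

text \<open>The Bessel inequality is recorded for finite partial sums, the form in which the
  estimates below use it.\<close>

locale bessel_kernels =
  fixes \<Theta> :: "complex \<Rightarrow> complex" and a :: "nat \<Rightarrow> complex" and \<eta> C :: real
  assumes inner: "inner_function \<Theta>"
    and a: "a n \<in> ball 0 1"
    and \<eta>: "norm (\<Theta> (a n)) \<le> \<eta>" "\<eta> < 1"
    and mem: "normalized_kernel \<Theta> (a n) \<in> model_space \<Theta>"
    and unit: "hnorm (normalized_kernel \<Theta> (a n)) = 1"
    and C_pos: "C > 0"
    and bessel: "f \<in> model_space \<Theta> \<Longrightarrow> finite F \<Longrightarrow>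
      (\<Sum>n\<in>F. (norm (hinner f (normalized_kernel \<Theta> (a n))))\<^sup>2) \<le> C * (hnorm f)\<^sup>2"
begin

abbreviation h :: "nat \<Rightarrow> complex \<Rightarrow> complex" where
  "h n \<equiv> normalized_kernel \<Theta> (a n)"

text \<open>The diagonal rescaling between normalized model kernels and normalized Szego kernels; it
  lies in (0, 1].\<close>

definition t :: "nat \<Rightarrow> real" where
  "t n = sqrt (1 - (norm (\<Theta> (a n)))\<^sup>2)"

lemma \<eta>_nonneg: "0 \<le> \<eta>"
  using \<eta>(1)[of 0] norm_ge_zero order_trans by blast

lemma \<eta>_sq: "\<eta>\<^sup>2 < 1"
  using \<eta>(2) \<eta>_nonneg by (simp add: power_less_one_iff)

lemma norm_\<Theta>_less_1: "norm (\<Theta> (a n)) < 1"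
  using \<eta>(1)[of n] \<eta>(2) by simp

lemma t_bounds: "0 < t n" "t n \<le> 1"
  using norm_\<Theta>_less_1[of n] by (auto simp: t_def power_less_one_iff)

lemma h_hardy2: "h n \<in> hardy2"
  using mem by (simp add: model_space_def)

lemma hinner_h:
  "hinner (h m) (h n) = (1 - cnj (\<Theta> (a m)) * \<Theta> (a n)) * szego_gram (a m) (a n) / (of_real (t m) * of_real (t n))"
  unfolding t_def by (intro hinner_normalized_kernel inner a norm_\<Theta>_less_1)

lemma comb_in_model_space: "finite F \<Longrightarrow> (\<lambda>z. \<Sum>n\<in>F. c n * h n z) \<in> model_space \<Theta>"
  by (intro model_space_sum inner mem normalized_kernel_radial_limit a)

lemma comb_hardy2: "finite F \<Longrightarrow> (\<lambda>z. \<Sum>n\<in>F. c n * h n z) \<in> hardy2"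
  by (intro hardy2_sum h_hardy2)

lemma hinner_comb_left:
  "finite F \<Longrightarrow> g \<in> hardy2 \<Longrightarrow> hinner (\<lambda>z. \<Sum>n\<in>F. c n * h n z) g = (\<Sum>n\<in>F. c n * hinner (h n) g)"
  by (intro hinner_sum_left h_hardy2 normalized_kernel_radial_limit inner a)

lemma hnorm_comb:
  assumes "finite F"
  shows "complex_of_real ((hnorm (\<lambda>z. \<Sum>n\<in>F. c n * h n z))\<^sup>2)
    = (\<Sum>m\<in>F. c m * cnj (hinner (\<lambda>z. \<Sum>n\<in>F. c n * h n z) (h m)))"
  unfolding hnorm_sq hinner_comb_left[OF assms comb_hardy2[OF assms]]
  by (simp only: hinner_cnj)

text \<open>Duality between analysis and synthesis: the squared norm of \<open>f\<close> is the
  pairing of its coefficients with the numbers \<open>hinner f (h m)\<close>. A weighted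
  arithmetic-geometric inequality and the Bessel bound for \<open>f\<close> leave half of this
  squared norm on the right, where it is absorbed.\<close>

lemma comb_upper_bound:
  assumes fin: "finite F"
  shows "(hnorm (\<lambda>z. \<Sum>n\<in>F. c n * h n z))\<^sup>2 \<le> C * (\<Sum>n\<in>F. (norm (c n))\<^sup>2)"
proof -
  define f where "f = (\<lambda>z. \<Sum>n\<in>F. c n * h n z)"
  have "(hnorm f)\<^sup>2 = norm (complex_of_real ((hnorm f)\<^sup>2))" by (subst norm_of_real) simp
  also have "\<dots> = norm (\<Sum>m\<in>F. c m * cnj (hinner f (h m)))"
    unfolding f_def hnorm_comb[OF fin] ..
  also have "\<dots> \<le> (\<Sum>m\<in>F. norm (c m) * norm (hinner f (h m)))"
    by (rule order_trans[OF norm_sum]) (simp add: norm_mult)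
  also have "\<dots> \<le> (\<Sum>m\<in>F. C / 2 * (norm (c m))\<^sup>2 + 1 / (2 * C) * (norm (hinner f (h m)))\<^sup>2)"
  proof (rule sum_mono)
    fix m
    let ?x = "norm (c m)" and ?y = "norm (hinner f (h m))"
    have "0 \<le> (C * ?x - ?y)\<^sup>2 / (2 * C)" using C_pos by simp
    also have "\<dots> = C / 2 * ?x\<^sup>2 + 1 / (2 * C) * ?y\<^sup>2 - ?x * ?y"
      using C_pos by (simp add: power2_eq_square field_simps)
    finally show "?x * ?y \<le> C / 2 * ?x\<^sup>2 + 1 / (2 * C) * ?y\<^sup>2" by simp
  qed
  also have "\<dots> = C / 2 * (\<Sum>m\<in>F. (norm (c m))\<^sup>2) + 1 / (2 * C) * (\<Sum>m\<in>F. (norm (hinner f (h m)))\<^sup>2)"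
    by (simp only: sum.distrib sum_distrib_left)
  also have "\<dots> \<le> C / 2 * (\<Sum>m\<in>F. (norm (c m))\<^sup>2) + 1 / (2 * C) * (C * (hnorm f)\<^sup>2)"
    unfolding f_def using C_pos
    by (intro add_left_mono mult_left_mono bessel comb_in_model_space fin) auto
  also have "\<dots> = C / 2 * (\<Sum>m\<in>F. (norm (c m))\<^sup>2) + (hnorm f)\<^sup>2 / 2"
    using C_pos by simp
  finally show ?thesis unfolding f_def[symmetric] by simp
qed

text \<open>The factors \<open>t\<close> cancel the denominators in \<open>hinner_h\<close>, and the
  two terms of \<open>1 - cnj (\<Theta> (a m)) * \<Theta> (a n)\<close> give the two Szego
  forms.\<close>

lemma hnorm_comb_szego_form:
  assumes fin: "finite F"
  shows "(hnorm (\<lambda>z. \<Sum>n\<in>F. (c n * of_real (t n)) * h n z))\<^sup>2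
    = szego_form a F c - szego_form a F (\<lambda>n. c n * cnj (\<Theta> (a n)))"
proof -
  have "complex_of_real ((hnorm (\<lambda>z. \<Sum>n\<in>F. (c n * of_real (t n)) * h n z))\<^sup>2)
    = (\<Sum>m\<in>F. (c m * of_real (t m)) * hinner (h m) (\<lambda>z. \<Sum>n\<in>F. (c n * of_real (t n)) * h n z))"
    unfolding hnorm_sq hinner_comb_left[OF fin comb_hardy2[OF fin]] ..
  also have "\<dots> = (\<Sum>m\<in>F. \<Sum>n\<in>F. c m * cnj (c n) * szego_gram (a m) (a n)
      - (c m * cnj (\<Theta> (a m))) * cnj (c n * cnj (\<Theta> (a n))) * szego_gram (a m) (a n))"
  proof (intro sum.cong refl)
    fix m assume "m \<in> F"
    have "hinner (h m) (\<lambda>z. \<Sum>n\<in>F. (c n * of_real (t n)) * h n z)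
        = cnj (\<Sum>n\<in>F. (c n * of_real (t n)) * hinner (h n) (h m))"
      unfolding hinner_comb_left[OF fin h_hardy2, symmetric] by (rule hinner_cnj[symmetric])
    also have "\<dots> = (\<Sum>n\<in>F. cnj (c n) * of_real (t n) * hinner (h m) (h n))"
      by (simp add: cnj_sum hinner_cnj)
    finally show "(c m * of_real (t m)) * hinner (h m) (\<lambda>z. \<Sum>n\<in>F. (c n * of_real (t n)) * h n z)
      = (\<Sum>n\<in>F. c m * cnj (c n) * szego_gram (a m) (a n)
      - (c m * cnj (\<Theta> (a m))) * cnj (c n * cnj (\<Theta> (a n))) * szego_gram (a m) (a n))"
      using t_bounds(1) by (simp add: hinner_h sum_distrib_left less_imp_neq[symmetric])
        (simp add: algebra_simps)
  qed
  also have "\<dots> = complex_of_real (szego_form a F c - szego_form a F (\<lambda>n. c n * cnj (\<Theta> (a n))))"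
    by (simp only: of_real_diff szego_form_gram[OF a] sum_subtractf)
  finally show ?thesis by (simp only: of_real_eq_iff)
qed

definition \<mu> :: real where "\<mu> = C / (1 - \<eta>\<^sup>2)"

lemma \<mu>_pos: "\<mu> > 0"
  using C_pos \<eta>_sq by (simp add: \<mu>_def)

lemma szego_form_upper:
  assumes fin: "finite F"
  shows "szego_form a F c \<le> \<mu> * (\<Sum>n\<in>F. (norm (c n))\<^sup>2)"
  unfolding \<mu>_def
proof (rule szego_form_upper_bound[where w = "\<lambda>n. cnj (\<Theta> (a n))"])
  fix c :: "nat \<Rightarrow> complex"
  have "(hnorm (\<lambda>z. \<Sum>n\<in>F. (c n * of_real (t n)) * h n z))\<^sup>2
      \<le> C * (\<Sum>n\<in>F. (norm (c n * of_real (t n)))\<^sup>2)" by (rule comb_upper_bound[OF fin])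
  also have "\<dots> \<le> C * (1\<^sup>2 * (\<Sum>n\<in>F. (norm (c n))\<^sup>2))"
    using C_pos t_bounds by (intro mult_left_mono sum_norm_mult_sq_le) (auto simp: less_imp_le)
  finally show "szego_form a F c - szego_form a F (\<lambda>n. c n * cnj (\<Theta> (a n))) \<le> C * (\<Sum>n\<in>F. (norm (c n))\<^sup>2)"
    by (simp add: hnorm_comb_szego_form[OF fin])
qed (use fin a \<eta> \<eta>_nonneg C_pos in auto)

definition M :: real where "M = C / (1 - \<eta>\<^sup>2)\<^sup>2"

text \<open>Bessel's inequality for the unit vector \<open>h n\<close> bounds a row of squared model
  Gram entries. Passing to Szego entries costs at most the factor \<open>1 - \<eta>\<^sup>2\<close>
  per entry, because \<open>t \<le> 1\<close> and the numerator has modulus at least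
  \<open>1 - \<eta>\<^sup>2\<close>.\<close>

lemma szego_gram_row_sum:
  assumes fin: "finite F"
  shows "(\<Sum>k\<in>F. (norm (szego_gram (a n) (a k)))\<^sup>2) \<le> M"
proof -
  have entry: "(1 - \<eta>\<^sup>2) * norm (szego_gram (a n) (a k)) \<le> norm (hinner (h n) (h k))" for k
  proof -
    have "norm (cnj (\<Theta> (a n)) * \<Theta> (a k)) \<le> \<eta> * \<eta>"
      unfolding norm_mult complex_mod_cnj by (intro mult_mono \<eta> \<eta>_nonneg) simp
    then have "1 - \<eta>\<^sup>2 \<le> norm (1 - cnj (\<Theta> (a n)) * \<Theta> (a k))"
      using norm_triangle_ineq2[of 1 "cnj (\<Theta> (a n)) * \<Theta> (a k)"] by (simp add: power2_eq_square)
    then have "(1 - \<eta>\<^sup>2) * norm (szego_gram (a n) (a k))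
        \<le> norm (1 - cnj (\<Theta> (a n)) * \<Theta> (a k)) * norm (szego_gram (a n) (a k))"
      by (rule mult_right_mono) simp
    also have "\<dots> \<le> norm (1 - cnj (\<Theta> (a n)) * \<Theta> (a k)) * norm (szego_gram (a n) (a k)) / (t n * t k)"
    proof -
      have "0 < t n * t k" "t n * t k \<le> 1"
        using t_bounds[of n] t_bounds[of k] by (auto simp: mult_le_one)
      then show ?thesis by (simp add: pos_le_divide_eq mult_left_le)
    qed
    also have "\<dots> = norm (hinner (h n) (h k))"
      using t_bounds(1)[of n] t_bounds(1)[of k] by (simp add: hinner_h norm_mult norm_divide)
    finally show ?thesis .
  qed
  have "(1 - \<eta>\<^sup>2)\<^sup>2 * (norm (szego_gram (a n) (a k)))\<^sup>2 \<le> (norm (hinner (h n) (h k)))\<^sup>2" for k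
    using power_mono[OF entry[of k], of 2] \<eta>_sq by (simp add: power_mult_distrib)
  then have "(1 - \<eta>\<^sup>2)\<^sup>2 * (\<Sum>k\<in>F. (norm (szego_gram (a n) (a k)))\<^sup>2)
      \<le> (\<Sum>k\<in>F. (norm (hinner (h n) (h k)))\<^sup>2)"
    unfolding sum_distrib_left by (intro sum_mono)
  also have "\<dots> \<le> C * (hnorm (h n))\<^sup>2" by (intro bessel mem fin)
  finally show ?thesis using \<eta>_sq by (simp add: unit M_def field_simps)
qed

lemma separated_colouring:
  "\<exists>\<phi>::nat \<Rightarrow> nat. finite (range \<phi>) \<and>
     (\<forall>m n. m \<noteq> n \<longrightarrow> \<phi> m = \<phi> n \<longrightarrow> (norm (szego_gram (a m) (a n)))\<^sup>2 \<le> 1 / 2)"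
proof -
  define R where "R m n \<longleftrightarrow> (norm (szego_gram (a m) (a n)))\<^sup>2 > 1 / 2" for m n
  \<comment> \<open>Each neighbour uses more than 1/2 of the row sum \<open>M\<close>. A point is
    its own neighbour, its diagonal entry being 1; this is counted here and does no harm, as the
    colouring compares distinct points only.\<close>
  have deg: "card G \<le> nat \<lfloor>2 * M\<rfloor>" if "finite G" "\<forall>m\<in>G. R n m" for n G
  proof -
    have "real (card G) * (1 / 2) = (\<Sum>k\<in>G. 1 / 2)" by simp
    also have "\<dots> \<le> (\<Sum>k\<in>G. (norm (szego_gram (a n) (a k)))\<^sup>2)"
      using that(2) by (intro sum_mono) (auto simp: R_def less_imp_le)
    also have "\<dots> \<le> M" by (rule szego_gram_row_sum[OF that(1)])
    finally show ?thesis by (simp add: le_nat_floor)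
  qed
  have sym: "R n m" if "R m n" for m n
    using that by (simp add: R_def norm_szego_gram_commute[of "a n" "a m"])
  have "\<exists>\<phi>::nat \<Rightarrow> nat. (\<forall>n. \<phi> n \<le> nat \<lfloor>2 * M\<rfloor>) \<and> (\<forall>m n. m \<noteq> n \<longrightarrow> R m n \<longrightarrow> \<phi> m \<noteq> \<phi> n)"
    using sym deg by (rule bounded_degree_colouring)
  then obtain \<phi> :: "nat \<Rightarrow> nat"
    where \<phi>: "\<And>n. \<phi> n \<le> nat \<lfloor>2 * M\<rfloor>" "\<And>m n. m \<noteq> n \<Longrightarrow> R m n \<Longrightarrow> \<phi> m \<noteq> \<phi> n" by blast
  have "finite (range \<phi>)" by (rule finite_subset[of _ "{..nat \<lfloor>2 * M\<rfloor>}"]) (use \<phi>(1) in auto)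
  moreover have "(norm (szego_gram (a m) (a n)))\<^sup>2 \<le> 1 / 2" if "m \<noteq> n" "\<phi> m = \<phi> n" for m n
    using \<phi>(2)[OF that(1)] that(2) unfolding R_def by linarith
  ultimately show ?thesis by blast
qed

text \<open>The values of \<Theta> at the points lie in the unit disk, which is totally bounded;
  balls of radius \<epsilon>/2 give cells of diameter at most \<epsilon>.\<close>

lemma small_cells:
  assumes "\<epsilon> > 0"
  shows "\<exists>\<psi>::nat \<Rightarrow> complex. finite (range \<psi>) \<and>
     (\<forall>m n. \<psi> m = \<psi> n \<longrightarrow> norm (\<Theta> (a m) - \<Theta> (a n)) \<le> \<epsilon>)"
proof -
  obtain K where K: "finite K" "cball (0::complex) 1 \<subseteq> (\<Union>x\<in>K. ball x (\<epsilon> / 2))"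
    using compact_cball[of "0::complex" 1] assms unfolding compact_eq_totally_bounded by (meson half_gt_zero)
  have "\<exists>x\<in>K. dist x (\<Theta> (a n)) < \<epsilon> / 2" for n
    using K(2) norm_\<Theta>_less_1[of n] by (force simp: subset_iff)
  then obtain \<psi> where \<psi>: "\<And>n. \<psi> n \<in> K" "\<And>n. dist (\<psi> n) (\<Theta> (a n)) < \<epsilon> / 2" by metis
  have "norm (\<Theta> (a m) - \<Theta> (a n)) \<le> \<epsilon>" if "\<psi> m = \<psi> n" for m n
    using \<psi>(2)[of m] \<psi>(2)[of n] dist_triangle3[of "\<Theta> (a m)" "\<Theta> (a n)" "\<psi> m"] that
    by (simp add: dist_norm)
  moreover have "finite (range \<psi>)" by (rule finite_subset[OF _ K(1)]) (use \<psi>(1) in auto)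
  ultimately show ?thesis by blast
qed

text \<open>After rescaling by \<open>t\<close>, the squared norm is a difference of two Szego
  forms. On a separated family the first form is bounded below, and on a small cell the second is at
  most a fixed proportion of the first. The constants do not depend on the finite set
  \<open>F\<close>, so the bound holds along a whole infinite class.\<close>

lemma riesz_lower_bound:
  obtains \<epsilon> l where "\<epsilon> > 0" "l > 0"
    "\<And>F c. \<lbrakk>finite F; \<forall>m\<in>F. \<forall>n\<in>F. m \<noteq> n \<longrightarrow> (norm (szego_gram (a m) (a n)))\<^sup>2 \<le> 1 / 2;
       \<forall>m\<in>F. \<forall>n\<in>F. norm (\<Theta> (a m) - \<Theta> (a n)) \<le> \<epsilon>\<rbrakk> \<Longrightarrow>
     l * (\<Sum>n\<in>F. (norm (c n))\<^sup>2) \<le> (hnorm (\<lambda>z. \<Sum>n\<in>F. c n * h n z))\<^sup>2"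
proof -
  \<comment> \<open>This \<tau> makes \<open>(1 + \<tau>) * \<eta>\<^sup>2\<close> at most 1 minus
    half of \<open>1 - \<eta>\<^sup>2\<close>. The constant \<kappa> is the lower bound that
    \<open>szego_form_lower_bound\<close> yields with \<delta> = \<open>exp (- M)\<close>, and
    \<epsilon> solves \<open>(1 + 1 / \<tau>) * \<mu> * \<epsilon>\<^sup>2 = l\<close>. The error
    term then uses up half of the gain, and a quarter of \<open>1 - \<eta>\<^sup>2\<close>
    remains.\<close>
  define \<tau> where "\<tau> = (1 - \<eta>\<^sup>2) / 2"
  define \<kappa> where "\<kappa> = (exp (- M))\<^sup>2 / \<mu>"
  define \<epsilon> where "\<epsilon> = sqrt ((1 - \<eta>\<^sup>2) / 4 * \<kappa> / ((1 + 1 / \<tau>) * \<mu>))"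
  define l where "l = (1 - \<eta>\<^sup>2) / 4 * \<kappa>"
  have \<tau>: "\<tau> > 0" using \<eta>_sq by (simp add: \<tau>_def)
  have \<kappa>: "\<kappa> > 0" using \<mu>_pos by (simp add: \<kappa>_def)
  have l: "l > 0" using \<kappa> \<eta>_sq by (simp add: l_def)
  have den: "(1 + 1 / \<tau>) * \<mu> > 0" using \<tau> \<mu>_pos by (simp add: add_pos_pos)
  have \<epsilon>_pos: "\<epsilon> > 0" using l den unfolding \<epsilon>_def l_def by (simp only: real_sqrt_gt_zero divide_pos_pos)
  have \<epsilon>: "(1 + 1 / \<tau>) * \<mu> * \<epsilon>\<^sup>2 = l"
  proof -
    have "\<epsilon>\<^sup>2 = l / ((1 + 1 / \<tau>) * \<mu>)"
      unfolding \<epsilon>_def l_def[symmetric] using l den by (intro real_sqrt_pow2) simp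
    with den have "\<epsilon>\<^sup>2 * ((1 + 1 / \<tau>) * \<mu>) = l"
      by (subst (asm) nonzero_eq_divide_eq) (rule less_imp_neq[symmetric])
    then show ?thesis by (simp only: mult.commute)
  qed
  have "l * (\<Sum>n\<in>F. (norm (c n))\<^sup>2) \<le> (hnorm (\<lambda>z. \<Sum>n\<in>F. c n * h n z))\<^sup>2"
    if fin: "finite F" and sep: "\<forall>m\<in>F. \<forall>n\<in>F. m \<noteq> n \<longrightarrow> (norm (szego_gram (a m) (a n)))\<^sup>2 \<le> 1 / 2"
    and cell: "\<forall>m\<in>F. \<forall>n\<in>F. norm (\<Theta> (a m) - \<Theta> (a n)) \<le> \<epsilon>" for F c
  proof (cases "F = {}")
    case False
    \<comment> \<open>Any point of the family serves as reference; its conjugated value of \<Theta>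
      is the constant \<open>u\<close> of \<open>szego_form_mult_le\<close>.\<close>
    then obtain n0 where n0: "n0 \<in> F" by blast
    define d where "d n = c n / of_real (t n)" for n
    let ?q = "szego_form a F d" and ?\<sigma> = "\<Sum>n\<in>F. (norm (d n))\<^sup>2"
    have low: "\<kappa> * ?\<sigma> \<le> ?q"
    proof -
      have prod: "exp (- M) \<le> (\<Prod>k\<in>F-{n}. norm (blaschke (a k) (a n)))" if n: "n \<in> F" for n
      proof (rule blaschke_prod_lower_bound[OF fin n])
        fix k assume "k \<in> F - {n}"
        then have "k \<in> F" "n \<noteq> k" by auto
        with sep[rule_format, OF n] show "(norm (szego_gram (a n) (a k)))\<^sup>2 \<le> 1 / 2" by this
      qed (rule a szego_gram_row_sum[OF fin])+
      have "(exp (- M))\<^sup>2 * ?\<sigma> \<le> \<mu> * ?q"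
        by (rule szego_form_lower_bound[OF fin a exp_gt_zero prod \<mu>_pos szego_form_upper[OF fin]])
      then show ?thesis
        using \<mu>_pos unfolding \<kappa>_def times_divide_eq_left by (subst pos_divide_le_eq) (simp_all only: mult.commute)
    qed
    have "szego_form a F (\<lambda>n. d n * cnj (\<Theta> (a n)))
        \<le> (1 + \<tau>) * \<eta>\<^sup>2 * ?q + (1 + 1 / \<tau>) * \<mu> * \<epsilon>\<^sup>2 * ?\<sigma>"
    proof (rule szego_form_mult_le)
      show "norm (cnj (\<Theta> (a n0))) \<le> \<eta>" using \<eta>(1) by simp
      show "norm (cnj (\<Theta> (a n)) - cnj (\<Theta> (a n0))) \<le> \<epsilon>" if "n \<in> F" for n
        using cell[rule_format, OF that n0] by (simp flip: complex_cnj_diff)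
    qed (rule a less_imp_le[OF \<mu>_pos] \<tau> szego_form_upper[OF fin])+
    also have "(1 + \<tau>) * \<eta>\<^sup>2 * ?q \<le> (1 - 2 * (1 - \<eta>\<^sup>2) / 4) * ?q"
    proof (rule mult_right_mono[OF _ szego_form_nonneg])
      have "\<tau> * \<eta>\<^sup>2 \<le> \<tau>" using \<tau> \<eta>_sq by (simp add: mult_left_le)
      then have "(1 + \<tau>) * \<eta>\<^sup>2 \<le> \<eta>\<^sup>2 + \<tau>" by (simp add: algebra_simps)
      also have "\<dots> = 1 - 2 * (1 - \<eta>\<^sup>2) / 4" by (simp add: \<tau>_def field_simps)
      finally show "(1 + \<tau>) * \<eta>\<^sup>2 \<le> 1 - 2 * (1 - \<eta>\<^sup>2) / 4" .
    qed
    also have "(1 + 1 / \<tau>) * \<mu> * \<epsilon>\<^sup>2 * ?\<sigma> = (1 - \<eta>\<^sup>2) / 4 * (\<kappa> * ?\<sigma>)"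
      unfolding \<epsilon> unfolding l_def by (rule mult.assoc)
    also have "\<dots> \<le> (1 - \<eta>\<^sup>2) / 4 * ?q" using \<eta>_sq by (intro mult_left_mono low) simp
    finally have "(1 - \<eta>\<^sup>2) / 4 * ?q \<le> ?q - szego_form a F (\<lambda>n. d n * cnj (\<Theta> (a n)))"
      by (simp add: field_simps)
    also have "\<dots> = (hnorm (\<lambda>z. \<Sum>n\<in>F. c n * h n z))\<^sup>2"
      unfolding hnorm_comb_szego_form[OF fin, symmetric] d_def
      using t_bounds(1) by (simp add: less_imp_neq[symmetric])
    finally have "(1 - \<eta>\<^sup>2) / 4 * ?q \<le> (hnorm (\<lambda>z. \<Sum>n\<in>F. c n * h n z))\<^sup>2" .
    moreover have "l * ?\<sigma> \<le> (1 - \<eta>\<^sup>2) / 4 * ?q"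
      unfolding l_def mult.assoc using \<eta>_sq by (intro mult_left_mono low) simp
    moreover have "l * (\<Sum>n\<in>F. (norm (c n))\<^sup>2) \<le> l * ?\<sigma>"
    proof (intro mult_left_mono sum_mono power_mono)
      fix n
      show "norm (c n) \<le> norm (d n)"
        using t_bounds[of n] by (simp add: d_def norm_divide pos_le_divide_eq mult_left_le)
    qed (use l in auto)
    ultimately show ?thesis by linarith
  qed simp
  from that[OF \<epsilon>_pos l this] show thesis .
qed

text \<open>The separation colouring and the cell partition are refined to a common partition; both
  properties required by the lower bound pass to every finite subset of a block.\<close>

lemma splits: "splits_into_riesz_basic (model_space \<Theta>) h"
proof -
  obtain \<epsilon> l where \<epsilon>: "\<epsilon> > 0" and l: "l > 0" and low: "\<And>F c. finite F \<Longrightarrow>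
     (\<forall>m\<in>F. \<forall>n\<in>F. m \<noteq> n \<longrightarrow> (norm (szego_gram (a m) (a n)))\<^sup>2 \<le> 1 / 2) \<Longrightarrow>
     (\<forall>m\<in>F. \<forall>n\<in>F. norm (\<Theta> (a m) - \<Theta> (a n)) \<le> \<epsilon>) \<Longrightarrow>
     l * (\<Sum>n\<in>F. (norm (c n))\<^sup>2) \<le> (hnorm (\<lambda>z. \<Sum>n\<in>F. c n * h n z))\<^sup>2"
    by (rule riesz_lower_bound) blast
  obtain \<phi> :: "nat \<Rightarrow> nat" where \<phi>: "finite (range \<phi>)"
     "\<And>m n. m \<noteq> n \<Longrightarrow> \<phi> m = \<phi> n \<Longrightarrow> (norm (szego_gram (a m) (a n)))\<^sup>2 \<le> 1 / 2"
    using separated_colouring by blast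
  obtain \<psi> :: "nat \<Rightarrow> complex" where \<psi>: "finite (range \<psi>)"
     "\<And>m n. \<psi> m = \<psi> n \<Longrightarrow> norm (\<Theta> (a m) - \<Theta> (a n)) \<le> \<epsilon>"
    using small_cells[OF \<epsilon>] by blast
  define \<rho> where "\<rho> n = (\<phi> n, \<psi> n)" for n
  \<comment> \<open>Fibres are taken over \<open>range \<rho>\<close> only, so that no block is
    empty.\<close>
  define P where "P = (\<lambda>b. \<rho> -` {b}) ` range \<rho>"
  have "finite (range \<rho>)"
    by (rule finite_subset[of _ "range \<phi> \<times> range \<psi>"]) (use \<phi>(1) \<psi>(1) in \<open>auto simp: \<rho>_def\<close>)
  then have "finite P" by (simp add: P_def)
  moreover have "partition_on UNIV P"
    by (rule partition_onI) (auto simp: P_def disjnt_def)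
  moreover have "riesz_basic_sequence (model_space \<Theta>) I h" if "I \<in> P" for I
  proof -
    from that obtain b where I: "I = \<rho> -` {b}" by (auto simp: P_def)
    \<comment> \<open>One constant must serve both inequalities: \<open>C + 1 / l\<close> is at
      least \<open>C\<close>, and its inverse is at most \<open>l\<close>.\<close>
    have "inverse (C + 1 / l) * (\<Sum>n\<in>F. (norm (c n))\<^sup>2) \<le> (hnorm (\<lambda>z. \<Sum>n\<in>F. c n * h n z))\<^sup>2 \<and>
        (hnorm (\<lambda>z. \<Sum>n\<in>F. c n * h n z))\<^sup>2 \<le> (C + 1 / l) * (\<Sum>n\<in>F. (norm (c n))\<^sup>2)"
      if F: "finite F" "F \<subseteq> I" for F c
    proof
      have eq: "\<phi> m = \<phi> n" "\<psi> m = \<psi> n" if "m \<in> F" "n \<in> F" for m n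
        using subsetD[OF F(2) that(1)] subsetD[OF F(2) that(2)] by (auto simp: I \<rho>_def)
      have "inverse (C + 1 / l) \<le> inverse (1 / l)"
        using l C_pos by (intro le_imp_inverse_le) auto
      then have "inverse (C + 1 / l) * (\<Sum>n\<in>F. (norm (c n))\<^sup>2) \<le> l * (\<Sum>n\<in>F. (norm (c n))\<^sup>2)"
        by (intro mult_right_mono sum_nonneg) auto
      also have "\<dots> \<le> (hnorm (\<lambda>z. \<Sum>n\<in>F. c n * h n z))\<^sup>2"
        by (intro low F(1) ballI impI \<phi>(2) \<psi>(2) eq)
      finally show "inverse (C + 1 / l) * (\<Sum>n\<in>F. (norm (c n))\<^sup>2) \<le> (hnorm (\<lambda>z. \<Sum>n\<in>F. c n * h n z))\<^sup>2" .
      have "C * (\<Sum>n\<in>F. (norm (c n))\<^sup>2) \<le> (C + 1 / l) * (\<Sum>n\<in>F. (norm (c n))\<^sup>2)"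
        using l by (intro mult_right_mono sum_nonneg) auto
      with comb_upper_bound[OF F(1), of c]
      show "(hnorm (\<lambda>z. \<Sum>n\<in>F. c n * h n z))\<^sup>2 \<le> (C + 1 / l) * (\<Sum>n\<in>F. (norm (c n))\<^sup>2)" by simp
    qed
    moreover have "C + 1 / l > 0" using l C_pos by (simp add: add_pos_pos)
    ultimately show ?thesis
      unfolding riesz_basic_sequence_def using mem by (intro conjI ballI exI[of _ "C + 1 / l"]) auto
  qed
  ultimately show ?thesis unfolding splits_into_riesz_basic_def by blast
qed

end

theorem theorem2p1:
  fixes \<Theta> :: "complex \<Rightarrow> complex" and a :: "nat \<Rightarrow> complex"
  assumes "inner_function \<Theta>"
    and "\<And>n. a n \<in> ball 0 1"
    and "(SUP n. norm (\<Theta> (a n))) < 1"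
    and "bessel_sequence (model_space \<Theta>) (\<lambda>n. normalized_kernel \<Theta> (a n))"
  shows "splits_into_riesz_basic (model_space \<Theta>) (\<lambda>n. normalized_kernel \<Theta> (a n))"
proof -
  let ?h = "\<lambda>n. normalized_kernel \<Theta> (a n)"
  from assms(4) have mem: "?h n \<in> model_space \<Theta>" and unit: "hnorm (?h n) = 1" for n
    by (auto simp: bessel_sequence_def)
  from assms(4) obtain C where C: "C > 0"
    and le: "\<forall>f\<in>model_space \<Theta>. summable (\<lambda>n. (norm (hinner f (?h n)))\<^sup>2) \<and>
      (\<Sum>n. (norm (hinner f (?h n)))\<^sup>2) \<le> C * (hnorm f)\<^sup>2"
    unfolding bessel_sequence_def by (elim conjE exE)
  from assms(1) obtain B where "\<And>z. z \<in> ball 0 1 \<Longrightarrow> norm (\<Theta> z) \<le> B"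
    unfolding inner_function_def bounded_iff by blast
  \<comment> \<open>A real supremum bounds its family only if that family is bounded above;
    boundedness of \<Theta> on the disk supplies this.\<close>
  with assms(2) have "bdd_above (range (\<lambda>n. norm (\<Theta> (a n))))" by (intro bdd_aboveI[of _ B]) blast
  then have sup: "norm (\<Theta> (a n)) \<le> (SUP n. norm (\<Theta> (a n)))" for n by (intro cSUP_upper) auto
  interpret bessel_kernels \<Theta> a "SUP n. norm (\<Theta> (a n))" C
  proof unfold_locales
    fix f F assume f: "f \<in> model_space \<Theta>" and F: "finite (F :: nat set)"
    note le = bspec[OF le f]
    have "(\<Sum>n\<in>F. (norm (hinner f (?h n)))\<^sup>2) \<le> (\<Sum>n. (norm (hinner f (?h n)))\<^sup>2)"
      by (intro sum_le_suminf conjunct1[OF le] F) simp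
    also note conjunct2[OF le]
    finally show "(\<Sum>n\<in>F. (norm (hinner f (?h n)))\<^sup>2) \<le> C * (hnorm f)\<^sup>2" .
  qed (fact assms C mem unit sup)+
  show ?thesis by (rule splits)
qed

end
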